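(* Let $N\ge 3$, let $B_1\subset\mathbb{R}^N$ be the open unit ball, and let $a:[0,1]\to\mathbb{R}$ be such that $x\mapsto a(|x|)$ belongs to $C^2(\overline{B_1})$, $a(r)>0$ on $[0,1]$, and $a(0)=1$. Consider radial solutions $(\lambda,u)$, with $\lambda>0$ and $u\in C^2(\overline{B_1})$ radially symmetric, of $$-\Delta u=\lambda a(|x|)e^{u}\ \text{ in } B_1,\qquad u>0\ \text{ in } B_1,\qquad u=0\ \text{ on }\partial B_1 .$$ Then, with $\lambda(\beta)$ and $u_\beta$ as defined in the context, the set of all radial solutions is $$\{(\lambda(\beta),u_\beta)\,;\ \beta\in\mathbb{R}\},$$ and $\alpha(\beta):=\lVert u_\beta\rVert_{L^\infty(B_1)}$ satisfies $\alpha(\beta)=\beta-\log\lambda(\beta)$ for every $\beta\in\mathbb{R}$. Moreover, the branch $\mathcal{C}:=\{(\lambda(\beta),\alpha(\beta));\ \beta\in\mathbb{R}\}$ is an unbounded analytic curve (the map $\beta\mapsto(\lambda(\beta),\alpha(\beta))$ is real analytic) emanating from $(0,0)$ (that is, $(\lambda(\beta),\alpha(\beta))\to(0,0)$ as $\beta\to-\infty$), and there exists $0<\lambda^*<\infty$ such that $\lambda(\beta)\le\lambda^*$ for all $\beta\in\mathbb{R}$.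
   Context: Radial functions are identified with functions of $r=|x|$, and then $\Delta=\frac{d^2}{dr^2}+\frac{N-1}{r}\frac{d}{dr}$. For $\beta\in\mathbb{R}$, $v(\cdot,\beta)$ denotes the solution on $[0,1]$ of $$-\Delta v=a(r)e^{v},\qquad v(0,\beta)=\beta,\qquad \tfrac{d}{dr}v(0,\beta)=0 ,$$ and one sets $\lambda(\beta):=e^{v(1,\beta)}$ and $u_\beta(r):=v(r,\beta)-\log\lambda(\beta)$. *)

theory Defs
  imports "HOL-Analysis.Analysis" "HOL-Probability.Essential_Supremum"
begin

text \<open>\<open>C\<^sup>2\<close> up to the boundary: for an open set \<open>S\<close>, the function is twice continuously
  differentiable in \<open>S\<close>, and it and its first and second derivatives extend continuously to
  \<open>closure S\<close>. The values of \<open>f\<close> outside \<open>closure S\<close> are irrelevant.\<close>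

definition C2_up_to_boundary :: "'a::euclidean_space set \<Rightarrow> ('a \<Rightarrow> real) \<Rightarrow> bool" where
  "C2_up_to_boundary S f \<longleftrightarrow>
     (\<exists>(f' :: 'a \<Rightarrow> 'a \<Rightarrow>\<^sub>L real) (f'' :: 'a \<Rightarrow> 'a \<Rightarrow>\<^sub>L ('a \<Rightarrow>\<^sub>L real)).
        continuous_on (closure S) f \<and>
        continuous_on (closure S) f' \<and>
        continuous_on (closure S) f'' \<and>
        (\<forall>x\<in>S. (f has_derivative blinfun_apply (f' x)) (at x)) \<and>
        (\<forall>x\<in>S. (f' has_derivative blinfun_apply (f'' x)) (at x)))"

definition partial_deriv :: "'a::euclidean_space \<Rightarrow> ('a \<Rightarrow> real) \<Rightarrow> 'a \<Rightarrow> real" where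
  "partial_deriv b f x = deriv (\<lambda>t. f (x + t *\<^sub>R b)) 0"

definition laplacian :: "('a::euclidean_space \<Rightarrow> real) \<Rightarrow> 'a \<Rightarrow> real" where
  "laplacian f x = (\<Sum>b\<in>Basis. partial_deriv b (partial_deriv b f) x)"

definition radial_solution ::
    "(real \<Rightarrow> real) \<Rightarrow> real \<Rightarrow> ('a::euclidean_space \<Rightarrow> real) \<Rightarrow> bool" where
  "radial_solution a lam u \<longleftrightarrow>
     0 < lam \<and>
     C2_up_to_boundary (ball 0 1) u \<and>
     (\<exists>w. \<forall>x\<in>cball 0 1. u x = w (norm x)) \<and>
     (\<forall>x\<in>ball 0 1. - laplacian u x = lam * a (norm x) * exp (u x)) \<and>
     (\<forall>x\<in>ball 0 1. 0 < u x) \<and>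
     (\<forall>x\<in>sphere 0 1. u x = 0)"

text \<open>Functions on the closed ball (or on \<open>[0,1]\<close>) are represented by HOL functions that are
  \<open>extensional\<close>, so that equality of representatives is equality on the domain.\<close>

definition radial_solutions ::
    "(real \<Rightarrow> real) \<Rightarrow> (real \<times> ('a::euclidean_space \<Rightarrow> real)) set" where
  "radial_solutions a = {(lam, u). radial_solution a lam u \<and> u \<in> extensional (cball 0 1)}"

text \<open>The radial initial value problem in dimension \<open>N\<close>; solutions are of class \<open>C\<^sup>2\<close> on \<open>[0,1]\<close>
  (one-sided derivatives at the end points). The equation is singular at \<open>r = 0\<close> and is
  imposed for \<open>0 < r \<le> 1\<close>.\<close>

definition radial_ivp_solution ::
    "nat \<Rightarrow> (real \<Rightarrow> real) \<Rightarrow> real \<Rightarrow> (real \<Rightarrow> real) \<Rightarrow> bool" where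
  "radial_ivp_solution N a \<beta> v \<longleftrightarrow>
     (\<exists>v' v''.
        (\<forall>r\<in>{0..1}. (v has_real_derivative v' r) (at r within {0..1})) \<and>
        (\<forall>r\<in>{0..1}. (v' has_real_derivative v'' r) (at r within {0..1})) \<and>
        continuous_on {0..1} v'' \<and>
        (\<forall>r\<in>{0<..1}. - (v'' r + (real N - 1) / r * v' r) = a r * exp (v r)) \<and>
        v 0 = \<beta> \<and> v' 0 = 0)"

definition ivp_sol :: "nat \<Rightarrow> (real \<Rightarrow> real) \<Rightarrow> real \<Rightarrow> real \<Rightarrow> real" where
  "ivp_sol N a \<beta> = (THE v. radial_ivp_solution N a \<beta> v \<and> v \<in> extensional {0..1})"

definition branch_lambda :: "nat \<Rightarrow> (real \<Rightarrow> real) \<Rightarrow> real \<Rightarrow> real" where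
  "branch_lambda N a \<beta> = exp (ivp_sol N a \<beta> 1)"

definition branch_u :: "(real \<Rightarrow> real) \<Rightarrow> real \<Rightarrow> 'a::euclidean_space \<Rightarrow> real" where
  "branch_u a \<beta> =
     (\<lambda>x\<in>cball 0 1. ivp_sol DIM('a) a \<beta> (norm x) - ln (branch_lambda DIM('a) a \<beta>))"

text \<open>The value is \<open>\<infinity>\<close> for functions that are not essentially bounded (or not measurable).\<close>

definition Linf_norm :: "'a::euclidean_space set \<Rightarrow> ('a \<Rightarrow> real) \<Rightarrow> ereal" where
  "Linf_norm S f = esssup (lebesgue_on S) (\<lambda>x. ereal \<bar>f x\<bar>)"

definition real_analytic_on ::
    "(real \<Rightarrow> 'b::real_normed_vector) \<Rightarrow> real set \<Rightarrow> bool" where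
  "real_analytic_on f S \<longleftrightarrow>
     (\<forall>x\<in>S. \<exists>\<rho>>0. \<exists>c. \<forall>y. \<bar>y - x\<bar> < \<rho> \<longrightarrow> (\<lambda>n. (y - x) ^ n *\<^sub>R c n) sums f y)"

end

theory Submission
  imports Defs "HOL-Complex_Analysis.Complex_Analysis"
begin

text \<open>Integrating twice turns the singular initial value problem into the Volterra equation
  \<open>v = \<beta> - K (a * exp v)\<close>, where \<open>K f (r) = \<integral>\<^sub>0\<^sup>r s\<^sup>1\<^sup>-\<^sup>N \<integral>\<^sub>0\<^sup>s t\<^sup>N\<^sup>-\<^sup>1 f (t) dt ds\<close> behaves
  regularly at \<open>0\<close>. Since \<open>K\<close> preserves positivity, \<open>v \<le> \<beta>\<close>, so the nonlinearity may be truncated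
  to a Lipschitz one and the solution exists on all of \<open>[0,1]\<close>. For complex data near a real \<open>\<beta>\<close>
  the same equation, written for the deviation from the real solution, is again solved by truncation;
  comparison with the linearised equation shows that the solution is complex differentiable in the
  datum, which gives analyticity of the branch. A radial function of class \<open>C\<^sup>2\<close> solves the boundary
  value problem exactly if its profile, shifted by \<open>ln \<lambda>\<close>, solves the initial value problem. Finally
  \<open>(exp (- v))' \<ge> min a * r / N\<close> because \<open>v\<close> decreases, so \<open>\<lambda> = exp (v 1) \<le> 2 * N / min a\<close>.\<close>

section \<open>The radial Green operator\<close>

text \<open>The coefficient (N - 1) / r is singular at 0, so the usual theory for regular initial
  value problems gives neither existence nor smooth dependence there. Existence, uniqueness,
  perturbation and linearisation therefore all rest on one weighted estimate: relative to the weight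
  exp (2 * L * r), a source that depends on the unknown with Lipschitz constant L has a potential
  with Lipschitz constant at most 1/2. This covers [0,1] at once, without continuing local
  solutions.

  The exponential is not globally Lipschitz, hence the truncations. In the real problem only large
  values do harm, and the bound v \<le> \<beta> excludes them. Complex values have no order; there
  the deviation from a real solution is used instead, because it vanishes for datum 0 and a
  stability estimate keeps it in the unit disc for small data. The projection onto that disc is not
  holomorphic, so differentiability is proved only once it has been seen to act trivially.

  The bound \<lambda> \<le> B also makes the branch unbounded: \<alpha> = \<beta> - ln \<lambda> is
  at least \<beta> - ln B.\<close>

definition radial_flux :: "nat \<Rightarrow> (real \<Rightarrow> 'b::banach) \<Rightarrow> real \<Rightarrow> 'b" where
  "radial_flux n f s = (1 / s ^ n) *\<^sub>R integral {0..s} (\<lambda>t. t ^ n *\<^sub>R f t)"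

definition radial_potential :: "nat \<Rightarrow> (real \<Rightarrow> 'b::banach) \<Rightarrow> real \<Rightarrow> 'b" where
  "radial_potential n f r = integral {0..r} (radial_flux n f)"

lemma weighted_integrable:
  fixes f :: "real \<Rightarrow> 'b::banach"
  assumes "continuous_on {0..1} f" "s \<le> 1"
  shows "(\<lambda>t. t ^ n *\<^sub>R f t) integrable_on {0..s}"
  using assms
  by (intro integrable_continuous_real continuous_intros) (auto elim: continuous_on_subset)

lemma has_integral_power:
  assumes "0 \<le> (s::real)"
  shows "((\<lambda>t. t ^ n) has_integral s ^ Suc n / (real n + 1)) {0..s}"
proof -
  have "((\<lambda>t. t ^ n) has_integral (s ^ Suc n / real (Suc n) - 0 ^ Suc n / real (Suc n))) {0..s}"
    using assms
    by (intro fundamental_theorem_of_calculus)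
      (auto intro!: derivative_eq_intros simp flip: has_real_derivative_iff_has_vector_derivative
        simp del: power_Suc of_nat_Suc)
  then show ?thesis by (simp add: add.commute)
qed

text \<open>The integral over \<open>{0..0}\<close> vanishes whatever \<open>1 / 0 ^ n\<close> is,
  and 0 is also the limit from the right for a continuous source. The definition thus needs no case
  split at the origin.\<close>

lemma radial_flux_0 [simp]: "radial_flux n f 0 = 0"
  by (simp add: radial_flux_def)

text \<open>Constant sources are the comparison functions: they give the derivative of the flux at
  0, its positivity and its lower bound.\<close>

lemma radial_flux_const:
  assumes "0 \<le> s"
  shows "radial_flux n (\<lambda>_. c :: 'b::banach) s = (s / (real n + 1)) *\<^sub>R c"
proof (cases "s = 0")
  case False
  have "((\<lambda>t. t ^ n *\<^sub>R c) has_integral (s ^ Suc n / (real n + 1)) *\<^sub>R c) {0..s}"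
    using has_integral_linear[OF has_integral_power[OF assms] bounded_linear_scaleR_left]
    by (simp add: o_def)
  with False show ?thesis
    by (simp add: radial_flux_def integral_unique)
qed auto

text \<open>The source is bounded only up to \<open>s\<close>, so that for an increasing weight the
  value at \<open>s\<close> can serve as \<open>b\<close>.\<close>

lemma radial_flux_bound:
  fixes f :: "real \<Rightarrow> 'b::banach"
  assumes "continuous_on {0..1} f" "s \<in> {0..1}"
    and bound: "\<And>t. t \<in> {0..s} \<Longrightarrow> norm (f t) \<le> b"
  shows "norm (radial_flux n f s) \<le> s / (real n + 1) * b"
proof (cases "s = 0")
  case False
  have "norm (integral {0..s} (\<lambda>t. t ^ n *\<^sub>R f t)) \<le> integral {0..s} (\<lambda>t. t ^ n * b)"
    using assms
    by (intro integral_norm_bound_integral weighted_integrable integrable_continuous_real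
        continuous_intros) (auto intro!: mult_left_mono)
  also have "\<dots> = s ^ Suc n / (real n + 1) * b"
    using has_integral_mult_left[OF has_integral_power[of s n], of b] assms(2)
    by (intro integral_unique) auto
  finally show ?thesis
    using assms(2) False by (simp add: radial_flux_def field_simps)
qed simp

lemma radial_flux_diff:
  fixes f g :: "real \<Rightarrow> 'b::banach"
  assumes "continuous_on {0..1} f" "continuous_on {0..1} g" "s \<in> {0..1}"
  shows "radial_flux n (\<lambda>t. f t - g t) s = radial_flux n f s - radial_flux n g s"
  using integral_diff[OF weighted_integrable[OF assms(1), of s n]
      weighted_integrable[OF assms(2), of s n]] assms(3)
  by (simp add: radial_flux_def scaleR_diff_right)

lemma radial_flux_linear:
  fixes f :: "real \<Rightarrow> 'b::banach" and T :: "'b \<Rightarrow> 'c::banach"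
  assumes "continuous_on {0..1} f" "s \<in> {0..1}" "bounded_linear T"
  shows "radial_flux n (\<lambda>t. T (f t)) s = T (radial_flux n f s)"
proof -
  interpret bounded_linear T by fact
  show ?thesis
    using integral_linear[OF weighted_integrable[OF assms(1), of s n] assms(3)] assms(2)
    by (simp add: radial_flux_def o_def scaleR)
qed

lemma radial_flux_mono:
  fixes f g :: "real \<Rightarrow> real"
  assumes "continuous_on {0..1} f" "continuous_on {0..1} g" "s \<in> {0..1}"
    and "\<And>t. t \<in> {0..s} \<Longrightarrow> f t \<le> g t"
  shows "radial_flux n f s \<le> radial_flux n g s"
  unfolding radial_flux_def using assms
  by (intro scaleR_left_mono integral_le weighted_integrable) (auto intro!: mult_left_mono)

text \<open>This is the divergence form (s^n p)' = s^n f of the radial equation for the flux p,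
  written as p' + (n / s) p = f.\<close>

lemma radial_flux_derivative:
  fixes f :: "real \<Rightarrow> 'b::banach"
  assumes f: "continuous_on {0..1} f" and s: "s \<in> {0<..1}"
  shows "(radial_flux n f has_vector_derivative f s - (real n / s) *\<^sub>R radial_flux n f s)
    (at s within {0..1})"
proof -
  let ?I = "\<lambda>s. integral {0..s} (\<lambda>t. t ^ n *\<^sub>R f t)"
  have I: "(?I has_vector_derivative s ^ n *\<^sub>R f s) (at s within {0..1})"
    using f s by (intro integral_has_vector_derivative continuous_intros) auto
  have "((\<lambda>s. 1 / s ^ n) has_real_derivative - (real n * s ^ (n - 1) / (s ^ n)\<^sup>2))
      (at s within {0..1})"
    using s by (auto intro!: derivative_eq_intros simp: power2_eq_square)
  from has_vector_derivative_scaleR[OF this I]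
  have "((\<lambda>s. (1 / s ^ n) *\<^sub>R ?I s) has_vector_derivative
     f s + (- (real n * s ^ (n - 1) / (s ^ n)\<^sup>2)) *\<^sub>R ?I s) (at s within {0..1})"
    using s by simp
  moreover have "f s + (- (real n * s ^ (n - 1) / (s ^ n)\<^sup>2)) *\<^sub>R ?I s
      = f s - (real n / s) *\<^sub>R radial_flux n f s"
    \<comment> \<open>Since \<open>n - 1\<close> is truncated subtraction, n = 0 is separate; both
      correction terms then vanish.\<close>
    using s by (cases n) (auto simp: radial_flux_def power2_eq_square)
  ultimately show ?thesis
    unfolding radial_flux_def[abs_def] by (simp only:)
qed

text \<open>The flux of the constant \<open>f 0\<close> is exactly linear. By continuity the rest
  \<open>f t - f 0\<close> is at most \<open>e\<close> near 0, so its flux is at most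
  \<open>e * y\<close>.\<close>

lemma radial_flux_derivative_0:
  fixes f :: "real \<Rightarrow> 'b::banach"
  assumes f: "continuous_on {0..1} f"
  shows "(radial_flux n f has_vector_derivative (1 / (real n + 1)) *\<^sub>R f 0) (at 0 within {0..1})"
  unfolding has_vector_derivative_def has_derivative_within_alt
proof (intro conjI allI impI)
  show "bounded_linear (\<lambda>x. x *\<^sub>R (1 / (real n + 1)) *\<^sub>R f 0)"
    by (rule bounded_linear_scaleR_left)
  fix e :: real assume "e > 0"
  with f obtain d where "d > 0" and d: "\<And>t. t \<in> {0..1} \<Longrightarrow> dist t 0 < d \<Longrightarrow> dist (f t) (f 0) < e"
    unfolding continuous_on_iff by (metis atLeastAtMost_iff order_refl zero_le_one)
  have "norm (radial_flux n f y - (y / (real n + 1)) *\<^sub>R f 0) \<le> e * y"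
    if y: "y \<in> {0..1}" "y < d" for y
  proof -
    have "radial_flux n f y - (y / (real n + 1)) *\<^sub>R f 0 = radial_flux n (\<lambda>t. f t - f 0) y"
      using f y by (subst radial_flux_diff) (auto simp: radial_flux_const)
    also have "norm \<dots> \<le> y / (real n + 1) * e"
      using f y d by (intro radial_flux_bound continuous_intros) (force simp: dist_norm)+
    also have "\<dots> \<le> y * e"
      using y \<open>e > 0\<close> by (intro mult_right_mono) (auto simp: field_simps)
    finally show ?thesis by (simp add: mult.commute)
  qed
  then show "\<exists>d>0. \<forall>y\<in>{0..1}. norm (y - 0) < d \<longrightarrow> norm (radial_flux n f y - radial_flux n f 0
      - (y - 0) *\<^sub>R (1 / (real n + 1)) *\<^sub>R f 0) \<le> e * norm (y - 0)"
    using \<open>d > 0\<close> by (intro exI[of _ d]) auto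
qed

lemma continuous_radial_flux:
  fixes f :: "real \<Rightarrow> 'b::banach"
  assumes "continuous_on {0..1} f"
  shows "continuous_on {0..1} (radial_flux n f)"
  unfolding continuous_on_eq_continuous_within
proof
  fix s :: real assume "s \<in> {0..1}"
  then show "continuous (at s within {0..1}) (radial_flux n f)"
    using has_vector_derivative_continuous[OF radial_flux_derivative[OF assms, of s n]]
      has_vector_derivative_continuous[OF radial_flux_derivative_0[OF assms, of n]]
    by (cases "s = 0") auto
qed

lemma radial_potential_derivative:
  fixes f :: "real \<Rightarrow> 'b::banach"
  assumes "continuous_on {0..1} f" "s \<in> {0..1}"
  shows "(radial_potential n f has_vector_derivative radial_flux n f s) (at s within {0..1})"
  unfolding radial_potential_def[abs_def]
  using integral_has_vector_derivative[OF continuous_radial_flux[OF assms(1)] assms(2)] .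

lemma continuous_radial_potential:
  fixes f :: "real \<Rightarrow> 'b::banach"
  assumes "continuous_on {0..1} f"
  shows "continuous_on {0..1} (radial_potential n f)"
  by (auto simp: continuous_on_eq_continuous_within
      intro: has_vector_derivative_continuous[OF radial_potential_derivative[OF assms]])

lemma radial_flux_integrable:
  fixes f :: "real \<Rightarrow> 'b::banach"
  assumes "continuous_on {0..1} f" "s \<in> {0..1}"
  shows "radial_flux n f integrable_on {0..s}"
  using assms
  by (intro integrable_continuous_real continuous_on_subset[OF continuous_radial_flux]) auto

lemma radial_potential_diff:
  fixes f g :: "real \<Rightarrow> 'b::banach"
  assumes "continuous_on {0..1} f" "continuous_on {0..1} g" "s \<in> {0..1}"
  shows "radial_potential n (\<lambda>t. f t - g t) s = radial_potential n f s - radial_potential n g s"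
proof -
  have "integral {0..s} (radial_flux n (\<lambda>t. f t - g t)) =
      integral {0..s} (\<lambda>r. radial_flux n f r - radial_flux n g r)"
    using assms by (intro integral_cong radial_flux_diff) auto
  then show ?thesis
    using assms by (simp add: radial_potential_def integral_diff radial_flux_integrable)
qed

text \<open>Used with negation, with multiplication by a complex constant, and with the embedding of
  the reals into the complex numbers.\<close>

lemma radial_potential_linear:
  fixes f :: "real \<Rightarrow> 'b::banach" and T :: "'b \<Rightarrow> 'c::banach"
  assumes "continuous_on {0..1} f" "s \<in> {0..1}" "bounded_linear T"
  shows "radial_potential n (\<lambda>t. T (f t)) s = T (radial_potential n f s)"
proof -
  have "integral {0..s} (radial_flux n (\<lambda>t. T (f t))) = integral {0..s} (T \<circ> radial_flux n f)"
    using assms by (intro integral_cong) (auto simp: radial_flux_linear)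
  then show ?thesis
    using assms by (simp add: radial_potential_def integral_linear radial_flux_integrable)
qed

text \<open>The Volterra property: only values of the source on [0,r] matter. It allows truncations
  to be removed and values outside [0,1] to be changed.\<close>

lemma radial_potential_cong:
  assumes "\<And>t. t \<in> {0..r} \<Longrightarrow> f t = g t"
  shows "radial_potential n f r = radial_potential n g r"
proof -
  have "integral {0..s} (\<lambda>t. t ^ n *\<^sub>R f t) = integral {0..s} (\<lambda>t. t ^ n *\<^sub>R g t)"
    if "s \<in> {0..r}" for s
    using that assms by (intro integral_cong) auto
  then show ?thesis
    unfolding radial_potential_def by (intro integral_cong) (simp add: radial_flux_def)
qed

lemma radial_potential_nonneg:
  fixes f :: "real \<Rightarrow> real"
  assumes "continuous_on {0..1} f" "r \<in> {0..1}" "\<And>t. t \<in> {0..1} \<Longrightarrow> 0 \<le> f t"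
  shows "0 \<le> radial_potential n f r"
proof -
  have "0 \<le> radial_flux n f s" if "s \<in> {0..r}" for s
    using radial_flux_mono[of "\<lambda>_. 0" f s n] radial_flux_const[of s n "0::real"] that assms by auto
  then show ?thesis
    unfolding radial_potential_def using assms
    by (intro integral_nonneg radial_flux_integrable) auto
qed

text \<open>The flux inherits the exponential bound because the weight increases and
  \<open>s / (real n + 1) \<le> 1\<close>. Integrating it gains the factor \<open>1 / L\<close>,
  which is the source of all contraction below.\<close>

lemma radial_potential_exp_bound:
  fixes f :: "real \<Rightarrow> 'b::banach"
  assumes f: "continuous_on {0..1} f" and r: "r \<in> {0..1}" and C: "0 \<le> C" and L: "0 < L"
    and bound: "\<And>t. t \<in> {0..1} \<Longrightarrow> norm (f t) \<le> C * exp (L * t)"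
  shows "norm (radial_potential n f r) \<le> C / L * (exp (L * r) - 1)"
proof -
  have int: "((\<lambda>s. C * exp (L * s)) has_integral (C / L * exp (L * r) - C / L * exp (L * 0))) {0..r}"
    using r L
    by (intro fundamental_theorem_of_calculus)
      (auto intro!: derivative_eq_intros simp flip: has_real_derivative_iff_has_vector_derivative)
  have flux: "norm (radial_flux n f s) \<le> C * exp (L * s)" if s: "s \<in> {0..r}" for s
  proof -
    have "norm (f t) \<le> C * exp (L * s)" if "t \<in> {0..s}" for t
    proof -
      have "norm (f t) \<le> C * exp (L * t)" using that s r by (intro bound) auto
      also have "\<dots> \<le> C * exp (L * s)" using that C L by (intro mult_left_mono) auto
      finally show ?thesis .
    qed
    then have "norm (radial_flux n f s) \<le> s / (real n + 1) * (C * exp (L * s))"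
      using s r f by (intro radial_flux_bound) auto
    also have "\<dots> \<le> 1 * (C * exp (L * s))"
      using s r C by (intro mult_right_mono) (auto simp: field_simps)
    finally show ?thesis by simp
  qed
  have "norm (radial_potential n f r) \<le> integral {0..r} (\<lambda>s. C * exp (L * s))"
    unfolding radial_potential_def using flux has_integral_integrable[OF int] f r
    by (intro integral_norm_bound_integral radial_flux_integrable) auto
  also have "\<dots> = C / L * (exp (L * r) - 1)"
    using integral_unique[OF int] by (simp add: algebra_simps)
  finally show ?thesis .
qed

section \<open>Volterra equations and the initial value problem\<close>

text \<open>The bound follows by maximising \<open>norm (d r) * exp (- 2 * L * r)\<close>: in this weighted norm the
  potential of \<open>q\<close> contributes at most half of the maximum.\<close>

lemma radial_gronwall:
  fixes d q :: "real \<Rightarrow> 'b::banach"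
  assumes d: "continuous_on {0..1} d" and q: "continuous_on {0..1} q"
    and L: "1 \<le> L" and c: "0 \<le> c" and e: "0 \<le> e"
    and d_le: "\<And>r. r \<in> {0..1} \<Longrightarrow> norm (d r) \<le> c + norm (radial_potential n q r)"
    and q_le: "\<And>t. t \<in> {0..1} \<Longrightarrow> norm (q t) \<le> L * norm (d t) + e"
    and r: "r \<in> {0..1}"
  shows "norm (d r) \<le> (2 * c + e) * exp (2 * L * r)"
proof -
  define g where "g = (\<lambda>r. norm (d r) * exp (- (2 * L * r)))"
  have "continuous_on {0..1} g"
    unfolding g_def by (intro continuous_intros d)
  then obtain s where s: "s \<in> {0..1}" and max: "\<And>t. t \<in> {0..1} \<Longrightarrow> g t \<le> g s"
    using continuous_attains_sup[of "{0..1::real}" g] by auto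
  define m where "m = g s"
  have m0: "0 \<le> m" by (simp add: m_def g_def)
  have d_exp: "norm (d t) \<le> m * exp (2 * L * t)" if "t \<in> {0..1}" for t
    using max[OF that] by (simp add: g_def m_def exp_minus field_simps)
  have "norm (q t) \<le> (L * m + e) * exp (2 * L * t)" if t: "t \<in> {0..1}" for t
  proof -
    have "norm (q t) \<le> L * (m * exp (2 * L * t)) + e"
      using q_le[OF t] mult_left_mono[OF d_exp[OF t], of L] L by linarith
    also have "e \<le> e * exp (2 * L * t)"
      using mult_left_mono[of 1 "exp (2 * L * t)" e] e L t by simp
    finally show ?thesis by (simp add: algebra_simps)
  qed
  then have "norm (radial_potential n q s) \<le> (L * m + e) / (2 * L) * (exp (2 * L * s) - 1)"
    using q s L m0 e by (intro radial_potential_exp_bound) auto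
  also have "\<dots> \<le> (m / 2 + e / 2) * exp (2 * L * s)"
  proof (rule mult_mono)
    show "(L * m + e) / (2 * L) \<le> m / 2 + e / 2"
      using L e mult_right_mono[of 1 L e] by (simp add: field_simps)
  qed (use L s m0 e in auto)
  finally have "norm (d s) \<le> c + (m / 2 + e / 2) * exp (2 * L * s)"
    using d_le[OF s] by linarith
  also have "c \<le> c * exp (2 * L * s)"
    using mult_left_mono[of 1 "exp (2 * L * s)" c] c L s by simp
  finally have "norm (d s) \<le> (c + m / 2 + e / 2) * exp (2 * L * s)"
    by (simp add: algebra_simps)
  moreover have "norm (d s) = m * exp (2 * L * s)"
    by (simp add: m_def g_def exp_minus)
  \<comment> \<open>Dividing by the weight at the maximum point leaves an inequality in
    \<open>m\<close> alone; absorbing \<open>m / 2\<close> on the left gives the constant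
    \<open>2 * c + e\<close>.\<close>
  ultimately have "m \<le> c + m / 2 + e / 2"
    by (metis exp_gt_zero mult_le_cancel_right_pos)
  then have "m \<le> 2 * c + e" by simp
  then have "m * exp (2 * L * r) \<le> (2 * c + e) * exp (2 * L * r)"
    by (intro mult_right_mono) auto
  with d_exp[OF r] show ?thesis by linarith
qed

text \<open>Picard iteration. Measured against \<open>exp (2 * L * r)\<close>, successive
  differences halve on the whole of [0,1], so the telescoping series of iterates converges uniformly
  by the M-test.\<close>

theorem radial_volterra_exists:
  fixes F :: "real \<Rightarrow> 'b \<Rightarrow> 'b::banach"
  assumes F: "continuous_on ({0..1} \<times> UNIV) (\<lambda>(t, x). F t x)" and L: "1 \<le> L"
    and lip: "\<And>t x y. t \<in> {0..1} \<Longrightarrow> norm (F t x - F t y) \<le> L * norm (x - y)"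
  obtains v where "continuous_on {0..1} v"
    "\<And>r. r \<in> {0..1} \<Longrightarrow> v r = c + radial_potential n (\<lambda>t. F t (v t)) r"
proof -
  have F_comp: "continuous_on {0..1} (\<lambda>t. F t (v t))" if "continuous_on {0..1} v" for v
  proof -
    have "continuous_on {0..1} (\<lambda>t. case (t, v t) of (t, x) \<Rightarrow> F t x)"
      by (rule continuous_on_compose2[OF F]) (auto intro!: continuous_intros that)
    then show ?thesis by simp
  qed
  define X where "X k = ((\<lambda>v r. c + radial_potential n (\<lambda>t. F t (v t)) r) ^^ k) (\<lambda>_. c)" for k
  have X_0: "X 0 = (\<lambda>_. c)"
    and X_Suc: "X (Suc k) = (\<lambda>r. c + radial_potential n (\<lambda>t. F t (X k t)) r)" for k
    by (simp_all add: X_def)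
  have X_cont: "continuous_on {0..1} (X k)" for k
    by (induction k)
      (auto simp: X_0 X_Suc intro!: continuous_intros continuous_radial_potential F_comp)
  have "bounded ((\<lambda>t. F t c) ` {0..1})"
    by (intro compact_imp_bounded compact_continuous_image F_comp) auto
  then obtain M where "0 < M" and M: "\<And>t. t \<in> {0..1} \<Longrightarrow> norm (F t c) \<le> M"
    unfolding bounded_pos by auto
  have exp_mono: "C / (2 * L) * (exp (2 * L * r) - 1) \<le> C * exp (2 * L * r)"
    if "0 \<le> C" "r \<in> {0..1}" for C r
    using that L mult_right_mono[of 1 L C] by (intro mult_mono) (auto simp: field_simps)
  have step: "norm (X (Suc k) r - X k r) \<le> M * (1 / 2) ^ k * exp (2 * L * r)"
    if "r \<in> {0..1}" for k r
    using that
  proof (induction k arbitrary: r)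
    case 0
    have "norm (radial_potential n (\<lambda>t. F t c) r) \<le> M / (2 * L) * (exp (2 * L * r) - 1)"
    proof (intro radial_potential_exp_bound F_comp)
      fix t :: real assume t: "t \<in> {0..1}"
      then have "M \<le> M * exp (2 * L * t)" using \<open>0 < M\<close> L by simp
      with M[OF t] show "norm (F t c) \<le> M * exp (2 * L * t)" by linarith
    qed (use 0 L \<open>0 < M\<close> in auto)
    also have "\<dots> \<le> M * exp (2 * L * r)"
      using 0 \<open>0 < M\<close> by (intro exp_mono) auto
    finally show ?case by (simp add: X_0 X_Suc)
  next
    case (Suc k)
    have "norm (F t (X (Suc k) t) - F t (X k t)) \<le> L * (M * (1 / 2) ^ k) * exp (2 * L * t)"
      if t: "t \<in> {0..1}" for t
    proof -
      have "L * norm (X (Suc k) t - X k t) \<le> L * (M * (1 / 2) ^ k * exp (2 * L * t))"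
        using L by (intro mult_left_mono Suc.IH t) auto
      with lip[OF t, of "X (Suc k) t" "X k t"] show ?thesis by (simp add: mult.assoc)
    qed
    then have "norm (radial_potential n (\<lambda>t. F t (X (Suc k) t) - F t (X k t)) r)
      \<le> L * (M * (1 / 2) ^ k) / (2 * L) * (exp (2 * L * r) - 1)"
      using Suc.prems L \<open>0 < M\<close>
      by (intro radial_potential_exp_bound continuous_intros F_comp X_cont) auto
    \<comment> \<open>The Lipschitz constant \<open>L\<close> cancels against the rate
      \<open>2 * L\<close> and leaves the new factor 1/2.\<close>
    also have "\<dots> \<le> M * (1 / 2) ^ Suc k * exp (2 * L * r)"
      using L Suc.prems \<open>0 < M\<close> by (intro mult_mono) auto
    finally show ?case
      unfolding X_Suc[of "Suc k"] X_Suc[of k]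
      using radial_potential_diff[OF F_comp[OF X_cont[of "Suc k"]] F_comp[OF X_cont[of k]] Suc.prems]
      by (simp add: X_Suc)
  qed
  have "uniformly_convergent_on {0..1} (\<lambda>k r. \<Sum>i<k. X (Suc i) r - X i r)"
  proof (rule Weierstrass_m_test')
    show "summable (\<lambda>k. M * (1 / 2) ^ k * exp (2 * L))"
      by (intro summable_mult2 summable_mult summable_geometric) auto
    fix k and r :: real assume r: "r \<in> {0..1}"
    have "M * (1 / 2) ^ k * exp (2 * L * r) \<le> M * (1 / 2) ^ k * exp (2 * L)"
      using r L \<open>0 < M\<close> by (intro mult_left_mono) auto
    with step[OF r, of k] show "norm (X (Suc k) r - X k r) \<le> M * (1 / 2) ^ k * exp (2 * L)"
      by linarith
  qed
  moreover have "(\<Sum>i<k. X (Suc i) r - X i r) = X k r - c" for k r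
    by (induction k) (auto simp: X_0)
  ultimately obtain w where w: "uniform_limit {0..1} (\<lambda>k r. X k r - c) w sequentially"
    unfolding uniformly_convergent_on_def by auto
  define v where "v r = c + w r" for r
  have lim: "uniform_limit {0..1} X v sequentially"
    using uniform_limit_add[OF uniform_limit_const w, of "\<lambda>_. c"] by (simp add: v_def[abs_def])
  have v: "continuous_on {0..1} v"
    using lim X_cont by (intro uniform_limit_theorem[OF _ lim]) auto
  have "v r = c + radial_potential n (\<lambda>t. F t (v t)) r" if r: "r \<in> {0..1}" for r
  proof (rule LIMSEQ_unique)
    show "(\<lambda>k. X (Suc k) r) \<longlonglongrightarrow> v r"
      using tendsto_uniform_limitI[OF lim r] by (rule LIMSEQ_Suc)
    have "(\<lambda>k. radial_potential n (\<lambda>t. F t (X k t)) r) \<longlonglongrightarrow> radial_potential n (\<lambda>t. F t (v t)) r"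
    proof (rule tendstoI)
      fix e :: real assume "e > 0"
      \<comment> \<open>Chosen for the exponential bound with rate 1: a uniform error
        \<open>e'\<close> in the iterate changes the potential by at most
        \<open>L * e' * (exp r - 1)\<close>, which is less than \<open>e\<close>.\<close>
      define e' where "e' = e / (L * exp 1)"
      have "e' > 0" using \<open>e > 0\<close> L by (simp add: e'_def)
      with lim have "\<forall>\<^sub>F k in sequentially. \<forall>t\<in>{0..1}. dist (X k t) (v t) < e'"
        by (rule uniform_limitD)
      then show "\<forall>\<^sub>F k in sequentially. dist (radial_potential n (\<lambda>t. F t (X k t)) r)
          (radial_potential n (\<lambda>t. F t (v t)) r) < e"
      proof eventually_elim
        case (elim k)
        have "norm (F t (X k t) - F t (v t)) \<le> (L * e') * exp (1 * t)" if t: "t \<in> {0..1}" for t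
        proof -
          have "norm (F t (X k t) - F t (v t)) \<le> L * e'"
          proof (rule order_trans[OF lip[OF t] mult_left_mono])
            show "norm (X k t - v t) \<le> e'" using elim t by (auto simp: dist_norm less_imp_le)
          qed (use L in auto)
          also have "\<dots> \<le> (L * e') * exp (1 * t)"
            using L \<open>e' > 0\<close> t by simp
          finally show ?thesis .
        qed
        then have "norm (radial_potential n (\<lambda>t. F t (X k t) - F t (v t)) r)
            \<le> L * e' / 1 * (exp (1 * r) - 1)"
          using r L \<open>e' > 0\<close>
          by (intro radial_potential_exp_bound continuous_intros F_comp X_cont v) auto
        also have "\<dots> < L * e' * exp 1"
          using r L \<open>e' > 0\<close> exp_le_cancel_iff[of r 1] unfolding div_by_1
          by (intro mult_strict_left_mono) (auto simp del: exp_le_cancel_iff)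
        also have "\<dots> = e" using L by (simp add: e'_def)
        finally show ?case
          using radial_potential_diff[OF F_comp[OF X_cont[of k]] F_comp[OF v] r]
          by (simp add: dist_norm)
      qed
    qed
    then show "(\<lambda>k. X (Suc k) r) \<longlonglongrightarrow> c + radial_potential n (\<lambda>t. F t (v t)) r"
      unfolding X_Suc by (intro tendsto_intros)
  qed
  with v show thesis by (rule that)
qed

text \<open>Removes the singularity of v' / r: filling in v'' 0 at the origin gives a continuous
  function on [0,1].\<close>

lemma continuous_on_quotient_0:
  fixes g :: "real \<Rightarrow> real"
  assumes g: "continuous_on {0..1} g" "g 0 = 0"
    and D: "(g has_real_derivative D) (at 0 within {0..1})"
  shows "continuous_on {0..1} (\<lambda>r. if r = 0 then D else g r / r)"
  unfolding continuous_on_eq_continuous_within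
proof
  fix s :: real assume s: "s \<in> {0..1}"
  show "continuous (at s within {0..1}) (\<lambda>r. if r = 0 then D else g r / r)"
  proof (cases "s = 0")
    case True
    have "((\<lambda>y. g y / y) \<longlongrightarrow> D) (at 0 within {0..1})"
      using D g by (simp add: has_field_derivative_iff)
    then have "((\<lambda>r. if r = 0 then D else g r / r) \<longlongrightarrow> D) (at 0 within {0..1})"
      by (rule Lim_transform_eventually) (auto simp: eventually_at intro: exI[of _ 1])
    with True show ?thesis by (simp add: continuous_within)
  next
    case False
    have "continuous (at s within {0..1}) (\<lambda>r. g r / r)"
      using g(1) s False by (intro continuous_intros) (auto simp: continuous_on_eq_continuous_within)
    then show ?thesis
      by (rule continuous_transform_within[where \<delta> = s])
        (use s False in \<open>auto simp: dist_real_def\<close>)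
  qed
qed

text \<open>Stating it for dimension \<open>Suc n\<close> makes the weight exponent N - 1 equal to
  \<open>n\<close>. The integral form asks for continuity only and mentions no derivative, so
  existence, uniqueness and restriction are all proved there.\<close>

theorem radial_ivp_solution_iff:
  assumes a: "continuous_on {0..1} a"
  shows "radial_ivp_solution (Suc n) a \<beta> v \<longleftrightarrow> continuous_on {0..1} v \<and>
    (\<forall>r\<in>{0..1}. v r = \<beta> - radial_potential n (\<lambda>t. a t * exp (v t)) r)"
    (is "?ivp \<longleftrightarrow> ?int")
proof
  let ?f = "\<lambda>t. a t * exp (v t)"
  assume ?int
  then have f: "continuous_on {0..1} ?f" and v: "\<And>r. r \<in> {0..1} \<Longrightarrow> v r = \<beta> - radial_potential n ?f r"
    using a by (auto intro!: continuous_intros)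
  define p where "p r = (if r = 0 then ?f 0 / (real n + 1) else radial_flux n ?f r / r)" for r
  have flux0: "(radial_flux n ?f has_real_derivative ?f 0 / (real n + 1)) (at 0 within {0..1})"
    using radial_flux_derivative_0[OF f, of n]
    by (simp add: has_real_derivative_iff_has_vector_derivative)
  have p: "continuous_on {0..1} p"
    unfolding p_def
    by (rule continuous_on_quotient_0[OF continuous_radial_flux[OF f] radial_flux_0 flux0])
  show ?ivp
    unfolding radial_ivp_solution_def
  proof (intro exI conjI ballI)
    show "continuous_on {0..1} (\<lambda>r. - (?f r - real n * p r))"
      by (intro continuous_intros p f)
    show "v 0 = \<beta>" using v[of 0] by (simp add: radial_potential_def)
    fix r :: real
    { assume r: "r \<in> {0..1}"
      have "((\<lambda>r. \<beta> - radial_potential n ?f r) has_real_derivative - radial_flux n ?f r) (at r within {0..1})"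
        using DERIV_diff[OF DERIV_const radial_potential_derivative[OF f r, of n,
              folded has_real_derivative_iff_has_vector_derivative]]
        by simp
      then show "(v has_real_derivative - radial_flux n ?f r) (at r within {0..1})"
        by (rule has_field_derivative_transform_within[where d = 1])
          (use r in \<open>auto simp: v[symmetric]\<close>)
      have "(radial_flux n ?f has_real_derivative ?f r - real n * p r) (at r within {0..1})"
      proof (cases "r = 0")
        case True
        \<comment> \<open>The derivative of the flux at 0 fits the formula valid for r > 0, with v'
          / r replaced by its limit; hence one expression gives a continuous second
          derivative.\<close>
        have "?f 0 - real n * (?f 0 / (real n + 1)) = ?f 0 / (real n + 1)"
          by (simp add: field_simps)
        with True flux0 show ?thesis by (simp add: p_def)
      next
        case False
        with radial_flux_derivative[OF f, of r n] r show ?thesis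
          by (simp add: p_def has_real_derivative_iff_has_vector_derivative)
      qed
      then show "((\<lambda>r. - radial_flux n ?f r) has_real_derivative - (?f r - real n * p r)) (at r within {0..1})"
        by (rule DERIV_minus)
    next
      assume r: "r \<in> {0<..1}"
      then show "- (- (?f r - real n * p r) + (real (Suc n) - 1) / r * - radial_flux n ?f r) = ?f r"
        by (simp add: p_def)
    }
  qed simp
next
  let ?f = "\<lambda>t. a t * exp (v t)"
  assume ?ivp
  then obtain v' v'' where v': "\<And>r. r \<in> {0..1} \<Longrightarrow> (v has_real_derivative v' r) (at r within {0..1})"
    and v'': "\<And>r. r \<in> {0..1} \<Longrightarrow> (v' has_real_derivative v'' r) (at r within {0..1})"
    and eq: "\<And>r. r \<in> {0<..1} \<Longrightarrow> - (v'' r + real n / r * v' r) = ?f r"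
    and init: "v 0 = \<beta>" "v' 0 = 0"
    unfolding radial_ivp_solution_def of_nat_Suc add_diff_cancel_left' by blast
  have v: "continuous_on {0..1} v" and v'c: "continuous_on {0..1} v'"
    using DERIV_continuous_on[OF v'] DERIV_continuous_on[OF v''] by auto
  have flux: "radial_flux n ?f r = - v' r" if r: "r \<in> {0..1}" for r
  proof (cases "r = 0")
    case False
    \<comment> \<open>The equation in the form (t^n v')' = - t^n f, needed only in the interior. The
      lower boundary term vanishes by \<open>v' 0 = 0\<close>, also for n = 0, where
      \<open>0 ^ n\<close> is 1.\<close>
    have "((\<lambda>t. - (t ^ n * ?f t)) has_integral r ^ n * v' r - 0 ^ n * v' 0) {0..r}"
    proof (rule fundamental_theorem_of_calculus_interior)
      show "continuous_on {0..r} (\<lambda>t. t ^ n * v' t)"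
        using r by (intro continuous_intros continuous_on_subset[OF v'c]) auto
      fix t assume t: "t \<in> {0<..<r}"
      have "(v' has_real_derivative v'' t) (at t)"
        using v''[of t] t r at_within_interior[of t "{0..1}"] by auto
      then have "((\<lambda>t. t ^ n * v' t) has_real_derivative real n * t ^ (n - 1) * v' t + t ^ n * v'' t) (at t)"
        by (auto intro!: derivative_eq_intros)
      also have "real n * t ^ (n - 1) * v' t + t ^ n * v'' t = - (t ^ n * ?f t)"
        using t r by (subst eq[symmetric]) (cases n; auto simp: field_simps)+
      finally show "((\<lambda>t. t ^ n * v' t) has_vector_derivative - (t ^ n * ?f t)) (at t)"
        by (simp add: has_real_derivative_iff_has_vector_derivative)
    qed (use r in auto)
    from has_integral_neg[OF this]
    have "integral {0..r} (\<lambda>t. t ^ n * ?f t) = - (r ^ n * v' r)"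
      using init by (intro integral_unique) simp
    with False r show ?thesis by (simp add: radial_flux_def)
  qed (use init in simp)
  have "v r = \<beta> - radial_potential n ?f r" if r: "r \<in> {0..1}" for r
  proof -
    have "(v' has_integral v r - v 0) {0..r}"
    proof (rule fundamental_theorem_of_calculus)
      fix t assume "t \<in> {0..r}"
      then show "(v has_vector_derivative v' t) (at t within {0..r})"
        using r v'[of t]
        by (auto simp flip: has_real_derivative_iff_has_vector_derivative intro: DERIV_subset)
    qed (use r in auto)
    from has_integral_neg[OF this] have "((\<lambda>t. - v' t) has_integral \<beta> - v r) {0..r}"
      using init by simp
    then have "(radial_flux n ?f has_integral \<beta> - v r) {0..r}"
      by (rule has_integral_eq[rotated]) (use flux r in auto)
    then show ?thesis by (simp add: radial_potential_def integral_unique)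
  qed
  with v show ?int by blast
qed

section \<open>Holomorphic dependence on the initial value\<close>

lemma norm_exp_diff_le:
  fixes x y :: "'a::{real_normed_field,banach}"
  assumes "norm x \<le> R" "norm y \<le> R"
  shows "norm (exp x - exp y) \<le> exp R * norm (x - y)"
proof (rule field_differentiable_bound[where S = "cball 0 R"])
  fix z :: 'a assume "z \<in> cball 0 R"
  then show "norm (exp z) \<le> exp R"
    using norm_exp[of z] by (auto intro: order_trans)
qed (use assms in \<open>auto intro!: derivative_eq_intros\<close>)

text \<open>On the half-line below \<open>R\<close> the derivative of exp is at most
  \<open>exp R\<close>, so upper bounds alone suffice. The a priori estimate v \<le> \<beta> is of
  exactly this kind.\<close>

lemma abs_exp_diff_le:
  fixes x y :: real
  assumes "x \<le> R" "y \<le> R"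
  shows "\<bar>exp x - exp y\<bar> \<le> exp R * \<bar>x - y\<bar>"
proof -
  have "norm (exp x - exp y) \<le> exp R * norm (x - y)"
    by (rule field_differentiable_bound[where S = "{..R}"])
      (use assms in \<open>auto intro: DERIV_subset[OF DERIV_exp]\<close>)
  then show ?thesis by simp
qed

lemma has_field_derivative_quadratic_error:
  fixes f :: "complex \<Rightarrow> complex"
  assumes "\<And>y. y \<in> S \<Longrightarrow> norm (f y - f x - (y - x) * D) \<le> C * (norm (y - x))\<^sup>2"
  shows "(f has_field_derivative D) (at x within S)"
  unfolding has_field_derivative_iff
proof (rule Lim_transform2[where f = "\<lambda>_. D"])
  have "((\<lambda>y. C * norm (y - x)) \<longlongrightarrow> C * norm (x - x)) (at x within S)"
    by (intro tendsto_intros)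
  then have lim: "((\<lambda>y. C * norm (y - x)) \<longlongrightarrow> 0) (at x within S)" by simp
  show "((\<lambda>y. D - (f y - f x) / (y - x)) \<longlongrightarrow> 0) (at x within S)"
  proof (rule Lim_null_comparison[OF _ lim])
    have "norm (D - (f y - f x) / (y - x)) \<le> C * norm (y - x)" if y: "y \<in> S" "y \<noteq> x" for y
    proof -
      have "(y - x) * (D - (f y - f x) / (y - x)) = - (f y - f x - (y - x) * D)"
        using y by (simp add: field_simps)
      then have "norm (y - x) * norm (D - (f y - f x) / (y - x)) \<le> C * (norm (y - x))\<^sup>2"
        using assms[OF y(1)] by (metis norm_minus_cancel norm_mult)
      then have "norm (y - x) * norm (D - (f y - f x) / (y - x)) \<le> norm (y - x) * (C * norm (y - x))"
        by (simp add: power2_eq_square mult_ac)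
      with y show ?thesis by (subst (asm) mult_le_cancel_left_pos) auto
    qed
    then show "\<forall>\<^sub>F y in at x within S. norm (D - (f y - f x) / (y - x)) \<le> C * norm (y - x)"
      by (auto simp: eventually_at intro!: exI[of _ 1])
  qed
qed auto

text \<open>With \<open>g = a * exp v\<close> for a solution \<open>v\<close>, the functions \<open>v + h z\<close> solve the complexified initial
  value problem with initial value \<open>v 0 + z\<close>.\<close>

theorem holomorphic_perturbation:
  fixes g :: "real \<Rightarrow> real"
  assumes g: "continuous_on {0..1} g"
  obtains \<rho> and h :: "complex \<Rightarrow> real \<Rightarrow> complex" where "0 < \<rho>"
    "\<And>z. z \<in> ball 0 \<rho> \<Longrightarrow> continuous_on {0..1} (h z)"
    "\<And>z r. z \<in> ball 0 \<rho> \<Longrightarrow> r \<in> {0..1} \<Longrightarrow> norm (h z r) \<le> 1"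
    "\<And>z r. z \<in> ball 0 \<rho> \<Longrightarrow> r \<in> {0..1} \<Longrightarrow>
       h z r = z + radial_potential n (\<lambda>t. - (g t *\<^sub>R (exp (h z t) - 1))) r"
    "\<And>r. r \<in> {0..1} \<Longrightarrow> (\<lambda>z. h z r) holomorphic_on ball 0 \<rho>"
proof -
  have "bounded (g ` {0..1})"
    by (intro compact_imp_bounded compact_continuous_image g) auto
  then obtain M0 where M0: "\<And>t. t \<in> {0..1} \<Longrightarrow> norm (g t) \<le> M0"
    unfolding bounded_pos by (meson imageI)
  define M where "M = max 1 M0"
  have M1: "1 \<le> M" and M: "\<And>t. t \<in> {0..1} \<Longrightarrow> \<bar>g t\<bar> \<le> M"
    using M0 by (simp_all add: M_def le_max_iff_disj)
  \<comment> \<open>On the unit disc \<open>exp 1\<close> bounds both the modulus of exp and its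
    Lipschitz constant, so the same \<open>L\<close> serves the truncated and the linearised
    equation.\<close>
  define L where "L = M * exp 1"
  have L: "1 \<le> L"
    using mult_mono[of 1 M 1 "exp 1"] M1 by (simp add: L_def)
  \<comment> \<open>The projection makes the nonlinearity globally Lipschitz; for small \<open>z\<close> it acts trivially.\<close>
  define P where "P = closest_point (cball (0::complex) 1)"
  have P_norm: "norm (P z) \<le> 1" for z
    using closest_point_in_set[of "cball (0::complex) 1" z] by (simp add: P_def)
  have P_self: "P z = z" if "norm z \<le> 1" for z
    using that by (simp add: P_def closest_point_self)
  have P_lip: "norm (P x - P y) \<le> norm (x - y)" for x y
    using closest_point_lipschitz[of "cball (0::complex) 1" x y] by (simp add: P_def dist_norm)
  have P_cont: "continuous_on T P" for T
    unfolding P_def by (intro continuous_on_closest_point) auto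
  have scale: "norm (- (g t *\<^sub>R x)) \<le> M * norm x" if "t \<in> {0..1}" for t and x :: complex
    using mult_right_mono[OF M[OF that], of "norm x"] by simp
  define F where "F t z = - (g t *\<^sub>R (exp (P z) - 1))" for t z
  have F_lip: "norm (F t x - F t y) \<le> L * norm (x - y)" if t: "t \<in> {0..1}" for t x y
  proof -
    have "F t x - F t y = - (g t *\<^sub>R (exp (P x) - exp (P y)))"
      by (simp add: F_def algebra_simps)
    also have "norm \<dots> \<le> M * norm (exp (P x) - exp (P y))" by (rule scale[OF t])
    also have "\<dots> \<le> M * (exp 1 * norm (P x - P y))"
      using M1 P_norm by (intro mult_left_mono norm_exp_diff_le) auto
    also have "\<dots> \<le> M * (exp 1 * norm (x - y))"
      using M1 P_lip by (intro mult_left_mono) auto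
    finally show ?thesis by (simp add: L_def)
  qed
  have g_fst: "continuous_on ({0..1} \<times> UNIV) (\<lambda>x::real \<times> complex. g (fst x))"
    by (rule continuous_on_compose2[OF g]) (auto intro!: continuous_intros)
  have F_cont: "continuous_on ({0..1} \<times> UNIV) (\<lambda>(t, x). F t x)"
    unfolding F_def case_prod_unfold
    by (intro continuous_intros continuous_on_compose2[OF P_cont[of UNIV]] g_fst) auto
  have "\<exists>v. continuous_on {0..1} v \<and> (\<forall>r\<in>{0..1}. v r = z + radial_potential n (\<lambda>t. F t (v t)) r)" for z
    using radial_volterra_exists[of F L z n, OF F_cont L F_lip] by metis
  then obtain h where h_cont: "\<And>z. continuous_on {0..1} (h z)"
    and h_F: "\<And>z r. r \<in> {0..1} \<Longrightarrow> h z r = z + radial_potential n (\<lambda>t. F t (h z t)) r"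
    by metis
  \<comment> \<open>Makes the Gronwall bound \<open>2 * norm (y - z) * exp (2 * L)\<close> equal to
    \<open>norm (y - z) / \<rho>\<close>. As \<open>h 0\<close> vanishes,
    \<open>norm z < \<rho>\<close> then forces \<open>norm (h z r) \<le> 1\<close>, where
    \<open>P\<close> is the identity.\<close>
  define \<rho> where "\<rho> = exp (- (2 * L)) / 2"
  have "0 < \<rho>" by (simp add: \<rho>_def)
  have F_h_cont: "continuous_on {0..1} (\<lambda>t. F t (h z t))" for z
    unfolding F_def
    by (intro continuous_intros continuous_on_compose2[OF P_cont[of UNIV]] g h_cont) auto
  have diff_le: "norm (h y r - h z r) \<le> norm (y - z) / \<rho>" if r: "r \<in> {0..1}" for y z r
  proof -
    have "norm (h y r - h z r) \<le> (2 * norm (y - z) + 0) * exp (2 * L * r)"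
    proof (rule radial_gronwall[where q = "\<lambda>t. F t (h y t) - F t (h z t)" and n = n])
      fix r :: real assume "r \<in> {0..1}"
      then have "h y r - h z r = (y - z) + radial_potential n (\<lambda>t. F t (h y t) - F t (h z t)) r"
        using h_F[of r y] h_F[of r z] radial_potential_diff[OF F_h_cont[of y] F_h_cont[of z]]
        by simp
      then show "norm (h y r - h z r)
          \<le> norm (y - z) + norm (radial_potential n (\<lambda>t. F t (h y t) - F t (h z t)) r)"
        by (metis norm_triangle_ineq)
    qed (use L r F_lip in \<open>auto intro!: continuous_intros h_cont F_h_cont\<close>)
    also have "\<dots> \<le> 2 * norm (y - z) * exp (2 * L)"
      using r L by (auto intro!: mult_left_mono)
    also have "\<dots> = norm (y - z) / \<rho>"
      by (simp add: \<rho>_def exp_minus field_simps)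
    finally show ?thesis .
  qed
  have h_0: "h 0 r = 0" if r: "r \<in> {0..1}" for r
  proof -
    have "norm (h 0 r) \<le> (2 * 0 + 0) * exp (2 * L * r)"
    proof (rule radial_gronwall[where q = "\<lambda>t. F t (h 0 t)" and n = n])
      fix t :: real assume "t \<in> {0..1}"
      from F_lip[OF this, of "h 0 t" 0] show "norm (F t (h 0 t)) \<le> L * norm (h 0 t) + 0"
        by (simp add: F_def P_self)
    next
      fix r :: real assume "r \<in> {0..1}"
      from h_F[OF this, of 0]
      show "norm (h 0 r) \<le> 0 + norm (radial_potential n (\<lambda>t. F t (h 0 t)) r)" by simp
    qed (use L r in \<open>auto intro!: h_cont F_h_cont\<close>)
    then show ?thesis by simp
  qed
  have h_le: "norm (h z r) \<le> 1" if "z \<in> ball 0 \<rho>" "r \<in> {0..1}" for z r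
  proof -
    have "norm (h z r) \<le> norm z / \<rho>"
      using diff_le[OF that(2), of z 0] h_0[OF that(2)] by simp
    also have "\<dots> \<le> 1" using that \<open>0 < \<rho>\<close> by simp
    finally show ?thesis .
  qed
  have h_eq: "h z r = z + radial_potential n (\<lambda>t. - (g t *\<^sub>R (exp (h z t) - 1))) r"
    if z: "z \<in> ball 0 \<rho>" and r: "r \<in> {0..1}" for z r
  proof -
    have "radial_potential n (\<lambda>t. F t (h z t)) r
        = radial_potential n (\<lambda>t. - (g t *\<^sub>R (exp (h z t) - 1))) r"
      using r by (intro radial_potential_cong) (auto simp: F_def P_self h_le[OF z])
    with h_F[OF r, of z] show ?thesis by simp
  qed
  have q_cont: "continuous_on {0..1} (\<lambda>t. - (g t *\<^sub>R (exp (h z t) - 1)))" for z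
    by (intro continuous_intros g h_cont)
  have "\<exists>D. ((\<lambda>z. h z r) has_field_derivative D) (at z within ball 0 \<rho>)"
    if z: "z \<in> ball 0 \<rho>" and r: "r \<in> {0..1}" for z r
  proof -
    \<comment> \<open>The derivative in \<open>z\<close> is the solution \<open>w\<close> of the equation linearised at \<open>h z\<close>.\<close>
    define G where "G t w = - (g t *\<^sub>R (exp (h z t) * w))" for t w
    have G_eq: "G t w = - (g t *\<^sub>R exp (h z t)) * w" for t w
      by (simp add: G_def)
    have exp_h: "norm (exp (h z t)) \<le> exp 1" if "t \<in> {0..1}" for t
      using norm_exp[of "h z t"] h_le[OF z that] by (meson exp_le_cancel_iff order_trans)
    have G_le: "norm (G t w) \<le> L * norm w" if t: "t \<in> {0..1}" for t w
    proof -
      have "norm (G t w) \<le> M * (norm (exp (h z t)) * norm w)"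
        unfolding G_def using scale[OF t, of "exp (h z t) * w"] by (simp add: norm_mult)
      also have "\<dots> \<le> M * (exp 1 * norm w)"
        using M1 exp_h[OF t] by (intro mult_left_mono mult_right_mono) auto
      finally show ?thesis by (simp add: L_def)
    qed
    have G_diff: "G t x - G t y = G t (x - y)" for t x y
      by (simp add: G_eq right_diff_distrib)
    have h_fst: "continuous_on ({0..1} \<times> UNIV) (\<lambda>x::real \<times> complex. h z (fst x))"
      by (rule continuous_on_compose2[OF h_cont[of z]]) (auto intro!: continuous_intros)
    have "continuous_on ({0..1} \<times> UNIV) (\<lambda>(t, x). G t x)"
      unfolding G_def case_prod_unfold by (intro continuous_intros g_fst h_fst)
    then obtain w where w_cont: "continuous_on {0..1} w"
      and w: "\<And>r. r \<in> {0..1} \<Longrightarrow> w r = 1 + radial_potential n (\<lambda>t. G t (w t)) r"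
      using radial_volterra_exists[of G L 1 n] L G_le G_diff by metis
    have Gw_cont: "continuous_on {0..1} (\<lambda>t. G t (w t))"
      unfolding G_def by (intro continuous_intros g h_cont w_cont)
    \<comment> \<open>Here \<open>exp 2\<close> comes from the Taylor remainder at an increment of
      norm at most 2, the square of \<open>\<rho>\<close> from squaring the Lipschitz bound on
      \<open>h\<close>, and \<open>exp (2 * L)\<close> from Gronwall.\<close>
    define C where "C = L * exp 2 / \<rho>\<^sup>2 * exp (2 * L)"
    have "norm (h y r - h z r - (y - z) * w r) \<le> C * (norm (y - z))\<^sup>2" if y: "y \<in> ball 0 \<rho>" for y
    proof -
      let ?q = "\<lambda>t. - (g t *\<^sub>R (exp (h y t) - 1)) - - (g t *\<^sub>R (exp (h z t) - 1)) - (y - z) * G t (w t)"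
      let ?e = "L * exp 2 / \<rho>\<^sup>2 * (norm (y - z))\<^sup>2"
      have "norm (h y r - h z r - (y - z) * w r) \<le> (2 * 0 + ?e) * exp (2 * L * r)"
      proof (rule radial_gronwall[where q = ?q and n = n])
        fix r :: real assume r: "r \<in> {0..1}"
        have "radial_potential n ?q r = radial_potential n (\<lambda>t. - (g t *\<^sub>R (exp (h y t) - 1))) r
          - radial_potential n (\<lambda>t. - (g t *\<^sub>R (exp (h z t) - 1))) r
          - (y - z) * radial_potential n (\<lambda>t. G t (w t)) r"
          using radial_potential_diff[OF continuous_on_diff[OF q_cont[of y] q_cont[of z]]
              continuous_on_mult_left[OF Gw_cont, of "y - z"] r]
            radial_potential_diff[OF q_cont[of y] q_cont[of z] r]
            radial_potential_linear[OF Gw_cont r bounded_linear_mult_right[of "y - z"]]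
          by simp
        also have "\<dots> = h y r - h z r - (y - z) * w r"
          using h_eq[OF y r] h_eq[OF z r] w[OF r] by (simp add: algebra_simps)
        finally show "norm (h y r - h z r - (y - z) * w r) \<le> 0 + norm (radial_potential n ?q r)"
          by simp
      next
        fix t :: real assume t: "t \<in> {0..1}"
        define x where "x = h y t - h z t"
        have x_le: "norm x \<le> norm (y - z) / \<rho>" unfolding x_def by (rule diff_le[OF t])
        have "norm x \<le> 2"
          using norm_triangle_ineq4[of "h y t" "h z t"] h_le[OF y t] h_le[OF z t] by (simp add: x_def)
        \<comment> \<open>Since exp (h y) - exp (h z) = exp (h z) (exp x - 1), splitting off the
          linear part of exp x leaves a quadratic remainder and the linearised operator applied to
          the error itself.\<close>
        have q: "?q t = G t (exp x - 1 - x) + G t (x - (y - z) * w t)"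
          by (simp add: G_eq x_def exp_diff scaleR_conv_of_real field_simps)
        have "norm (G t (exp x - 1 - x)) \<le> ?e"
        proof -
          have "norm (exp x - 1 - x) \<le> exp \<bar>Re x\<bar> * (norm x)\<^sup>2"
            using Taylor_exp[of x 1] by (simp add: numeral_2_eq_2 diff_diff_eq)
          also have "\<dots> \<le> exp 2 * (norm (y - z) / \<rho>)\<^sup>2"
            using abs_Re_le_cmod[of x] \<open>norm x \<le> 2\<close> x_le
            by (intro mult_mono power_mono) auto
          finally have "L * norm (exp x - 1 - x) \<le> L * (exp 2 * (norm (y - z) / \<rho>)\<^sup>2)"
            using L by (intro mult_left_mono) auto
          with G_le[OF t, of "exp x - 1 - x"] show ?thesis by (simp add: power_divide)
        qed
        moreover have "norm (G t (x - (y - z) * w t)) \<le> L * norm (h y t - h z t - (y - z) * w t)"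
          using G_le[OF t] by (simp add: x_def)
        ultimately show "norm (?q t) \<le> L * norm (h y t - h z t - (y - z) * w t) + ?e"
          unfolding q using norm_triangle_ineq[of "G t (exp x - 1 - x)" "G t (x - (y - z) * w t)"] by linarith
      qed (use L r in \<open>auto intro!: continuous_intros h_cont w_cont g Gw_cont\<close>)
      also have "\<dots> \<le> (2 * 0 + ?e) * exp (2 * L)"
        using r L by (intro mult_left_mono) auto
      finally show ?thesis by (simp add: C_def mult_ac)
    qed
    then show ?thesis by (blast intro: has_field_derivative_quadratic_error)
  qed
  then have "(\<lambda>z. h z r) holomorphic_on ball 0 \<rho>" if "r \<in> {0..1}" for r
    using that unfolding holomorphic_on_def field_differentiable_def by blast
  with \<open>0 < \<rho>\<close> h_cont h_le h_eq show thesis by (blast intro: that)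
qed

text \<open>The Taylor coefficients of \<open>F\<close> are complex, but \<open>y - x\<close> and
  \<open>f y\<close> are real, so taking real parts termwise gives a real series for
  \<open>f\<close>.\<close>

lemma holomorphic_imp_real_power_series:
  assumes F: "F holomorphic_on ball 0 \<rho>"
    and eq: "\<And>t. \<bar>t\<bar> < \<rho> \<Longrightarrow> F (of_real t) = of_real (f (x + t))"
  obtains c where "\<And>y. \<bar>y - x\<bar> < \<rho> \<Longrightarrow> (\<lambda>k. (y - x) ^ k * c k) sums f y"
proof
  fix y assume y: "\<bar>y - x\<bar> < \<rho>"
  let ?c = "\<lambda>k. (deriv ^^ k) F 0 / fact k"
  have "of_real (y - x) \<in> ball (0::complex) \<rho>"
    using y unfolding mem_ball_0 norm_of_real .
  from sums_Re[OF holomorphic_power_series[OF F this]]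
  have "(\<lambda>k. Re (?c k * of_real ((y - x) ^ k))) sums f y"
    using eq[OF y] by simp
  moreover have "Re (z * of_real r) = r * Re z" for z r by simp
  ultimately show "(\<lambda>k. (y - x) ^ k * Re (?c k)) sums f y" by (simp only:)
qed

text \<open>One radius is shared by both components so that their coefficients can be paired into a
  single power series.\<close>

lemma real_analytic_on_Pair:
  assumes "\<And>x. \<exists>\<rho>>0. \<exists>F G. F holomorphic_on ball 0 \<rho> \<and> G holomorphic_on ball 0 \<rho> \<and>
    (\<forall>t. \<bar>t\<bar> < \<rho> \<longrightarrow> F (of_real t) = of_real (f (x + t)) \<and> G (of_real t) = of_real (g (x + t)))"
  shows "real_analytic_on (\<lambda>x. (f x, g x)) UNIV"
  unfolding real_analytic_on_def
proof
  fix x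
  obtain \<rho> F G where \<rho>: "\<rho> > 0"
    and F: "F holomorphic_on ball 0 \<rho>" "\<And>t. \<bar>t\<bar> < \<rho> \<Longrightarrow> F (of_real t) = of_real (f (x + t))"
    and G: "G holomorphic_on ball 0 \<rho>" "\<And>t. \<bar>t\<bar> < \<rho> \<Longrightarrow> G (of_real t) = of_real (g (x + t))"
    using assms[of x] by blast
  obtain c where "\<And>y. \<bar>y - x\<bar> < \<rho> \<Longrightarrow> (\<lambda>k. (y - x) ^ k * c k) sums f y"
    using holomorphic_imp_real_power_series[OF F] by blast
  moreover obtain d where "\<And>y. \<bar>y - x\<bar> < \<rho> \<Longrightarrow> (\<lambda>k. (y - x) ^ k * d k) sums g y"
    using holomorphic_imp_real_power_series[OF G] by blast
  ultimately have "\<forall>y. \<bar>y - x\<bar> < \<rho> \<longrightarrow> (\<lambda>k. (y - x) ^ k *\<^sub>R (c k, d k)) sums (f y, g y)"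
    unfolding sums_def scaleR_Pair real_scaleR_def sum_prod by (intro allI impI tendsto_Pair) auto
  then have "\<exists>c. \<forall>y. \<bar>y - x\<bar> < \<rho> \<longrightarrow> (\<lambda>k. (y - x) ^ k *\<^sub>R c k) sums (f y, g y)"
    by (rule exI[of _ "\<lambda>k. (c k, d k)"])
  with \<rho> show "\<exists>\<rho>>0. \<exists>c. \<forall>y. \<bar>y - x\<bar> < \<rho> \<longrightarrow> (\<lambda>k. (y - x) ^ k *\<^sub>R c k) sums (f y, g y)"
    by (intro exI[of _ \<rho>] conjI)
qed

section \<open>The branch of the initial value problem\<close>

text \<open>\<open>n\<close> is N - 1, the exponent of the weight; the dimension N appears as
  \<open>Suc n\<close>.\<close>

locale radial_ode =
  fixes n :: nat and a :: "real \<Rightarrow> real"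
  assumes a_cont: "continuous_on {0..1} a" and a_pos: "\<And>r. r \<in> {0..1} \<Longrightarrow> 0 < a r"
begin

abbreviation sol :: "real \<Rightarrow> real \<Rightarrow> real" where
  "sol \<equiv> ivp_sol (Suc n) a"

lemma a_upper: obtains A where "1 \<le> A" "\<And>r. r \<in> {0..1} \<Longrightarrow> a r \<le> A"
proof -
  obtain s where "\<And>r. r \<in> {0..1} \<Longrightarrow> a r \<le> a s"
    using continuous_attains_sup[OF _ _ a_cont] by force
  then show thesis using that[of "max 1 (a s)"] by (simp add: le_max_iff_disj)
qed

lemma a_lower: obtains m where "0 < m" "\<And>r. r \<in> {0..1} \<Longrightarrow> m \<le> a r"
proof -
  obtain s where "s \<in> {0..1}" "\<And>r. r \<in> {0..1} \<Longrightarrow> a s \<le> a r"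
    using continuous_attains_inf[OF _ _ a_cont] by force
  then show thesis using that[of "a s"] a_pos by blast
qed

lemma source_continuous: "continuous_on {0..1} v \<Longrightarrow> continuous_on {0..1} (\<lambda>t. a t * exp (v t))"
  by (intro continuous_intros a_cont)

section \<open>Uniqueness and existence for the initial value problem\<close>

lemma ivp_le:
  assumes "radial_ivp_solution (Suc n) a \<beta> v" "r \<in> {0..1}"
  shows "v r \<le> \<beta>"
proof -
  have v: "continuous_on {0..1} v" "v r = \<beta> - radial_potential n (\<lambda>t. a t * exp (v t)) r"
    using assms radial_ivp_solution_iff[OF a_cont] by blast+
  have "0 \<le> radial_potential n (\<lambda>t. a t * exp (v t)) r"
    using assms(2) a_pos by (intro radial_potential_nonneg source_continuous v) (auto intro: less_imp_le)
  with v(2) show ?thesis by linarith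
qed

text \<open>Both solutions stay below \<beta>, where the source has a Lipschitz constant; Gronwall
  with zero data then forces equality.\<close>

lemma ivp_unique:
  assumes v: "radial_ivp_solution (Suc n) a \<beta> v" and w: "radial_ivp_solution (Suc n) a \<beta> w"
    and r: "r \<in> {0..1}"
  shows "v r = w r"
proof -
  obtain A where A: "1 \<le> A" "\<And>r. r \<in> {0..1} \<Longrightarrow> a r \<le> A" by (rule a_upper) blast
  define L where "L = max 1 (A * exp \<beta>)"
  have vc: "continuous_on {0..1} v" and wc: "continuous_on {0..1} w"
    and veq: "\<And>r. r \<in> {0..1} \<Longrightarrow> v r = \<beta> - radial_potential n (\<lambda>t. a t * exp (v t)) r"
    and weq: "\<And>r. r \<in> {0..1} \<Longrightarrow> w r = \<beta> - radial_potential n (\<lambda>t. a t * exp (w t)) r"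
    using v w radial_ivp_solution_iff[OF a_cont] by blast+
  have "norm (v r - w r) \<le> (2 * 0 + 0) * exp (2 * L * r)"
  proof (rule radial_gronwall[where q = "\<lambda>t. a t * exp (v t) - a t * exp (w t)" and n = n])
    fix r :: real assume r: "r \<in> {0..1}"
    show "norm (v r - w r) \<le> 0 + norm (radial_potential n (\<lambda>t. a t * exp (v t) - a t * exp (w t)) r)"
      unfolding radial_potential_diff[OF source_continuous[OF vc] source_continuous[OF wc] r]
      using veq[OF r] weq[OF r] by (simp only: real_norm_def)
    have "norm (a r * exp (v r) - a r * exp (w r)) = a r * \<bar>exp (v r) - exp (w r)\<bar>"
      using a_pos[OF r] by (simp add: abs_mult flip: right_diff_distrib)
    also have "\<dots> \<le> A * (exp \<beta> * \<bar>v r - w r\<bar>)"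
      using A r a_pos[OF r] by (intro mult_mono abs_exp_diff_le ivp_le[OF v] ivp_le[OF w]) auto
    also have "\<dots> \<le> L * \<bar>v r - w r\<bar>"
      by (simp add: L_def mult_right_mono flip: mult.assoc)
    finally show "norm (a r * exp (v r) - a r * exp (w r)) \<le> L * norm (v r - w r) + 0" by simp
  qed (use r in \<open>auto simp: L_def intro!: continuous_on_diff source_continuous vc wc\<close>)
  then show ?thesis by simp
qed

text \<open>The bound by \<beta> has to be derived for the truncated equation itself. Its source is
  still positive, so the same sign argument applies, and the truncation turns out never to
  act.\<close>

lemma ivp_exists: "\<exists>v. radial_ivp_solution (Suc n) a \<beta> v"
proof -
  obtain A where A: "1 \<le> A" "\<And>r. r \<in> {0..1} \<Longrightarrow> a r \<le> A" by (rule a_upper) blast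
  define L where "L = max 1 (A * exp \<beta>)"
  define F where "F t x = - (a t * exp (min x \<beta>))" for t x
  have a_fst: "continuous_on ({0..1} \<times> UNIV) (\<lambda>x::real \<times> real. a (fst x))"
    by (rule continuous_on_compose2[OF a_cont]) (auto intro!: continuous_intros)
  have "continuous_on ({0..1} \<times> UNIV) (\<lambda>(t, x). F t x)"
    unfolding F_def case_prod_unfold by (intro continuous_intros a_fst)
  moreover have "1 \<le> L" by (simp add: L_def)
  moreover have "norm (F t x - F t y) \<le> L * norm (x - y)" if t: "t \<in> {0..1}" for t x y
  proof -
    have "F t x - F t y = - (a t * (exp (min x \<beta>) - exp (min y \<beta>)))"
      by (simp add: F_def algebra_simps)
    then have "norm (F t x - F t y) = a t * \<bar>exp (min x \<beta>) - exp (min y \<beta>)\<bar>"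
      using a_pos[OF t] by (simp add: abs_mult)
    also have "\<dots> \<le> A * (exp \<beta> * \<bar>min x \<beta> - min y \<beta>\<bar>)"
      using A t a_pos[OF t] by (intro mult_mono abs_exp_diff_le) auto
    also have "\<dots> \<le> A * (exp \<beta> * \<bar>x - y\<bar>)"
      using A by (intro mult_left_mono) auto
    also have "\<dots> \<le> L * \<bar>x - y\<bar>"
      by (simp add: L_def mult_right_mono flip: mult.assoc)
    finally show ?thesis by simp
  qed
  ultimately obtain v where vc: "continuous_on {0..1} v"
    and v: "\<And>r. r \<in> {0..1} \<Longrightarrow> v r = \<beta> + radial_potential n (\<lambda>t. F t (v t)) r"
    using radial_volterra_exists[of F L \<beta> n] by metis
  have mc: "continuous_on {0..1} (\<lambda>t. a t * exp (min (v t) \<beta>))"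
    by (intro source_continuous continuous_intros vc)
  have v2: "v r = \<beta> - radial_potential n (\<lambda>t. a t * exp (min (v t) \<beta>)) r" if r: "r \<in> {0..1}" for r
    using v[OF r] radial_potential_linear[OF mc r bounded_linear_minus[OF bounded_linear_ident], of n]
    by (simp add: F_def)
  have le: "v r \<le> \<beta>" if r: "r \<in> {0..1}" for r
    using radial_potential_nonneg[OF mc r, of n] a_pos v2[OF r] by (fastforce intro: less_imp_le)
  have "v r = \<beta> - radial_potential n (\<lambda>t. a t * exp (v t)) r" if r: "r \<in> {0..1}" for r
  proof -
    have "radial_potential n (\<lambda>t. a t * exp (min (v t) \<beta>)) r = radial_potential n (\<lambda>t. a t * exp (v t)) r"
      using r le by (intro radial_potential_cong) (simp add: min_absorb1)
    with v2[OF r] show ?thesis by simp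
  qed
  with vc radial_ivp_solution_iff[OF a_cont] show ?thesis by blast
qed

text \<open>Normalising the values off [0,1] makes the object described by \<open>ivp_sol\<close>
  unique.\<close>

lemma ivp_restrict:
  assumes "radial_ivp_solution (Suc n) a \<beta> v"
  shows "radial_ivp_solution (Suc n) a \<beta> (restrict v {0..1})"
proof -
  have v: "continuous_on {0..1} v" "\<And>r. r \<in> {0..1} \<Longrightarrow> v r = \<beta> - radial_potential n (\<lambda>t. a t * exp (v t)) r"
    using assms radial_ivp_solution_iff[OF a_cont] by blast+
  have "continuous_on {0..1} (restrict v {0..1})"
    using v(1) by (rule continuous_on_eq) auto
  moreover have "restrict v {0..1} r = \<beta> - radial_potential n (\<lambda>t. a t * exp (restrict v {0..1} t)) r"
    if r: "r \<in> {0..1}" for r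
  proof -
    have "radial_potential n (\<lambda>t. a t * exp (restrict v {0..1} t)) r = radial_potential n (\<lambda>t. a t * exp (v t)) r"
      using r by (intro radial_potential_cong) auto
    with v(2)[OF r] r show ?thesis by simp
  qed
  ultimately show ?thesis using radial_ivp_solution_iff[OF a_cont] by blast
qed

lemma sol: "radial_ivp_solution (Suc n) a \<beta> (sol \<beta>) \<and> sol \<beta> \<in> extensional {0..1}"
proof -
  obtain v where v: "radial_ivp_solution (Suc n) a \<beta> v" using ivp_exists by blast
  have "\<exists>!v. radial_ivp_solution (Suc n) a \<beta> v \<and> v \<in> extensional {0..1}"
  proof (rule ex1I)
    show "radial_ivp_solution (Suc n) a \<beta> (restrict v {0..1}) \<and> restrict v {0..1} \<in> extensional {0..1}"
      using ivp_restrict[OF v] by simp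
    fix w assume "radial_ivp_solution (Suc n) a \<beta> w \<and> w \<in> extensional {0..1}"
    then show "w = restrict v {0..1}"
      using ivp_unique[OF _ ivp_restrict[OF v]] by (intro extensionalityI[of w "{0..1}"]) auto
  qed
  from theI'[OF this] show ?thesis unfolding ivp_sol_def .
qed

lemma sol_unique: "radial_ivp_solution (Suc n) a \<beta> v \<Longrightarrow> r \<in> {0..1} \<Longrightarrow> v r = sol \<beta> r"
  using ivp_unique sol by blast

lemma sol_le: "r \<in> {0..1} \<Longrightarrow> sol \<beta> r \<le> \<beta>"
  using ivp_le sol by blast

lemma sol_continuous: "continuous_on {0..1} (sol \<beta>)"
  and sol_integral_eq: "r \<in> {0..1} \<Longrightarrow> sol \<beta> r = \<beta> - radial_potential n (\<lambda>t. a t * exp (sol \<beta> t)) r"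
  using sol radial_ivp_solution_iff[OF a_cont] by blast+

lemma sol_0: "sol \<beta> 0 = \<beta>"
  using sol unfolding radial_ivp_solution_def by blast

lemmas source_sol = source_continuous[OF sol_continuous]

lemma sol_derivative:
  assumes r: "r \<in> {0<..<1}"
  shows "(sol \<beta> has_real_derivative - radial_flux n (\<lambda>t. a t * exp (sol \<beta> t)) r) (at r)"
proof -
  let ?f = "\<lambda>t. a t * exp (sol \<beta> t)"
  have "((\<lambda>r. \<beta> - radial_potential n ?f r) has_real_derivative - radial_flux n ?f r) (at r within {0..1})"
    using r DERIV_diff[OF DERIV_const radial_potential_derivative[OF source_sol[of \<beta>], of r n,
          folded has_real_derivative_iff_has_vector_derivative]]
    by simp
  then have "(sol \<beta> has_real_derivative - radial_flux n ?f r) (at r within {0..1})"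
    by (rule has_field_derivative_transform_within[where d = 1])
      (use r in \<open>auto simp: sol_integral_eq[symmetric]\<close>)
  then show ?thesis
    using r at_within_interior[of r "{0..1}"] by simp
qed

section \<open>Monotonicity and size of the solutions\<close>

lemma radial_flux_source_pos:
  assumes r: "r \<in> {0<..1}"
  shows "0 < radial_flux n (\<lambda>t. a t * exp (sol \<beta> t)) r"
proof -
  obtain s where s: "s \<in> {0..1}"
    and min: "\<And>t. t \<in> {0..1} \<Longrightarrow> a s * exp (sol \<beta> s) \<le> a t * exp (sol \<beta> t)"
    using continuous_attains_inf[OF _ _ source_sol, of \<beta>] by force
  have "0 < r / (real n + 1) * (a s * exp (sol \<beta> s))"
    using r a_pos[OF s] by simp
  also have "\<dots> = radial_flux n (\<lambda>_. a s * exp (sol \<beta> s)) r"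
    using r radial_flux_const[of r n "a s * exp (sol \<beta> s)"] by simp
  also have "\<dots> \<le> radial_flux n (\<lambda>t. a t * exp (sol \<beta> t)) r"
    using r min by (intro radial_flux_mono source_sol) auto
  finally show ?thesis .
qed

lemma sol_strict_decreasing:
  assumes "0 \<le> r" "r < s" "s \<le> 1"
  shows "sol \<beta> s < sol \<beta> r"
proof (rule DERIV_neg_imp_decreasing_open[OF assms(2)])
  fix t assume "r < t" "t < s"
  then show "\<exists>y. (sol \<beta> has_real_derivative y) (at t) \<and> y < 0"
    using assms sol_derivative[of t \<beta>] radial_flux_source_pos[of t \<beta>] by (intro exI conjI) auto
qed (use assms in \<open>auto intro: continuous_on_subset[OF sol_continuous]\<close>)

lemma sol_decreasing: "0 \<le> r \<Longrightarrow> r \<le> s \<Longrightarrow> s \<le> 1 \<Longrightarrow> sol \<beta> s \<le> sol \<beta> r"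
  using sol_strict_decreasing[of r s \<beta>] by (cases "r = s") auto

lemma exp_sol_bounded: obtains B where "0 < B" "\<And>\<beta>. exp (sol \<beta> 1) \<le> B"
proof -
  obtain m where m: "0 < m" "\<And>r. r \<in> {0..1} \<Longrightarrow> m \<le> a r" by (rule a_lower) blast
  define k where "k = m / (real n + 1)"
  have "0 < k" using m by (simp add: k_def)
  have "exp (sol \<beta> 1) \<le> 2 / k" for \<beta>
  proof -
    let ?f = "\<lambda>t. a t * exp (sol \<beta> t)"
    let ?\<phi> = "\<lambda>r. exp (- sol \<beta> r) - k * r\<^sup>2 / 2"
    have "?\<phi> 0 \<le> ?\<phi> 1"
    proof (rule DERIV_nonneg_imp_increasing_open[of 0 1])
      fix r :: real assume r: "0 < r" "r < 1"
      \<comment> \<open>On [0,r] the source is at least \<open>m * exp (sol \<beta> r)\<close>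
        because \<open>sol\<close> decreases. Multiplying by \<open>exp (- sol \<beta> r)\<close>
        cancels all dependence on \<beta>, hence the choice of exp (- v).\<close>
      have "r / (real n + 1) * (m * exp (sol \<beta> r)) = radial_flux n (\<lambda>_. m * exp (sol \<beta> r)) r"
        using r radial_flux_const[of r n "m * exp (sol \<beta> r)"] by simp
      also have "\<dots> \<le> radial_flux n ?f r"
        using r m sol_decreasing a_pos[THEN less_imp_le]
        by (intro radial_flux_mono source_sol continuous_intros mult_mono) auto
      finally have "exp (- sol \<beta> r) * (r / (real n + 1) * (m * exp (sol \<beta> r)))
          \<le> exp (- sol \<beta> r) * radial_flux n ?f r"
        by (intro mult_left_mono) auto
      then have "k * r \<le> exp (- sol \<beta> r) * radial_flux n ?f r"
        by (simp add: k_def exp_minus field_simps)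
      moreover have "(?\<phi> has_real_derivative exp (- sol \<beta> r) * radial_flux n ?f r - k * r) (at r)"
        using r by (auto intro!: derivative_eq_intros sol_derivative)
      ultimately show "\<exists>y. (?\<phi> has_real_derivative y) (at r) \<and> 0 \<le> y"
        by (intro exI conjI) auto
    qed (auto intro!: continuous_intros sol_continuous)
    then have "exp (- sol \<beta> 0) + k / 2 \<le> exp (- sol \<beta> 1)" by simp
    moreover have "0 < exp (- sol \<beta> 0)" by simp
    ultimately have "k / 2 \<le> exp (- sol \<beta> 1)" by linarith
    with \<open>0 < k\<close> show ?thesis by (simp add: exp_minus field_simps)
  qed
  with \<open>0 < k\<close> show thesis by (intro that[of "2 / k"]) auto
qed

text \<open>As \<open>sol \<beta> \<le> \<beta>\<close>, the source is at most
  \<open>A * exp \<beta>\<close>, and so is its potential up to a constant. This makes \<alpha> of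
  order exp \<beta> as \<beta> tends to minus infinity.\<close>

lemma sol_lower: obtains A where "\<And>\<beta>. \<beta> - A * exp \<beta> \<le> sol \<beta> 1"
proof -
  obtain A where A: "1 \<le> A" "\<And>r. r \<in> {0..1} \<Longrightarrow> a r \<le> A" by (rule a_upper) blast
  have "\<beta> - A * exp 1 * exp \<beta> \<le> sol \<beta> 1" for \<beta>
  proof -
    let ?f = "\<lambda>t. a t * exp (sol \<beta> t)"
    have "norm (radial_potential n ?f 1) \<le> A * exp \<beta> / 1 * (exp (1 * 1) - 1)"
    proof (intro radial_potential_exp_bound source_sol)
      fix t :: real assume t: "t \<in> {0..1}"
      have "norm (?f t) = a t * exp (sol \<beta> t)" using a_pos[OF t] by simp
      also have "\<dots> \<le> A * exp \<beta>"
        using A t a_pos[OF t] sol_le[OF t] by (intro mult_mono) auto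
      also have "\<dots> \<le> A * exp \<beta> * exp (1 * t)" using A t by simp
      finally show "norm (?f t) \<le> A * exp \<beta> * exp (1 * t)" .
    qed (use A in auto)
    also have "\<dots> \<le> A * exp 1 * exp \<beta>" using A by (simp add: algebra_simps)
    finally show ?thesis using sol_integral_eq[of 1 \<beta>] by simp
  qed
  then show thesis by (rule that)
qed

text \<open>For real \<delta> the deviation \<open>h\<close> must be identified with
  \<open>sol (\<beta> + \<delta>) - sol \<beta>\<close>. Both satisfy the same equation and both are
  bounded, so Gronwall applies on a disc containing their values.\<close>

lemma sol_holomorphic_extension:
  obtains \<rho> H where "0 < \<rho>" "H holomorphic_on ball 0 \<rho>"
    "\<And>t. \<bar>t\<bar> < \<rho> \<Longrightarrow> H (of_real t) = of_real (sol (\<beta> + t) 1)"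
proof -
  let ?f = "\<lambda>\<beta> t. a t * exp (sol \<beta> t)"
  obtain \<rho> h where "0 < \<rho>"
    and h_cont: "\<And>z. z \<in> ball 0 \<rho> \<Longrightarrow> continuous_on {0..1} (h z)"
    and h_le: "\<And>z r. z \<in> ball 0 \<rho> \<Longrightarrow> r \<in> {0..1} \<Longrightarrow> norm (h z r) \<le> 1"
    and h_eq: "\<And>z r. z \<in> ball 0 \<rho> \<Longrightarrow> r \<in> {0..1} \<Longrightarrow>
       h z r = z + radial_potential n (\<lambda>t. - (?f \<beta> t *\<^sub>R (exp (h z t) - 1))) r"
    and h_hol: "\<And>r. r \<in> {0..1} \<Longrightarrow> (\<lambda>z. h z r) holomorphic_on ball 0 \<rho>"
    by (rule holomorphic_perturbation[OF source_sol[of \<beta>], of n]) blast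
  have "h (of_real \<delta>) 1 = of_real (sol (\<beta> + \<delta>) 1 - sol \<beta> 1)" if \<delta>: "\<bar>\<delta>\<bar> < \<rho>" for \<delta>
  proof -
    define d where "d r = sol (\<beta> + \<delta>) r - sol \<beta> r" for r
    define \<eta> where "\<eta> = h (of_real \<delta>)"
    have z: "of_real \<delta> \<in> ball (0::complex) \<rho>" using \<delta> by simp
    have d_cont: "continuous_on {0..1} d"
      unfolding d_def by (intro continuous_intros sol_continuous)
    have \<eta>_cont: "continuous_on {0..1} \<eta>" unfolding \<eta>_def by (rule h_cont[OF z])
    have "bounded (d ` {0..1})"
      by (intro compact_imp_bounded compact_continuous_image d_cont) auto
    then obtain R0 where R0: "\<And>t. t \<in> {0..1} \<Longrightarrow> norm (d t) \<le> R0"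
      unfolding bounded_pos by (meson imageI)
    define R where "R = max 1 R0"
    obtain s where s: "\<And>t. t \<in> {0..1} \<Longrightarrow> ?f \<beta> t \<le> ?f \<beta> s"
      using continuous_attains_sup[OF _ _ source_sol, of \<beta>] by force
    define M where "M = max 1 (?f \<beta> s)"
    have M: "\<bar>?f \<beta> t\<bar> \<le> M" if "t \<in> {0..1}" for t
      using s[OF that] a_pos[OF that] by (simp add: M_def le_max_iff_disj abs_mult)
    let ?q = "\<lambda>t. - (?f \<beta> t *\<^sub>R (exp (\<eta> t) - 1)) - of_real (- (?f (\<beta> + \<delta>) t - ?f \<beta> t))"
    have "norm (\<eta> 1 - of_real (d 1)) \<le> (2 * 0 + 0) * exp (2 * (M * exp R) * 1)"
    proof (rule radial_gronwall[where q = ?q and n = n and r = 1])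
      show "continuous_on {0..1} (\<lambda>r. \<eta> r - of_real (d r))"
        by (intro continuous_intros \<eta>_cont d_cont)
      have q1: "continuous_on {0..1} (\<lambda>t. - (?f \<beta> t *\<^sub>R (exp (\<eta> t) - 1)))"
        by (intro continuous_intros source_sol \<eta>_cont)
      have q2: "continuous_on {0..1} (\<lambda>t. - (?f (\<beta> + \<delta>) t - ?f \<beta> t))"
        by (intro continuous_intros source_sol)
      have q2c: "continuous_on {0..1} (\<lambda>t. of_real (- (?f (\<beta> + \<delta>) t - ?f \<beta> t)) :: complex)"
        by (intro continuous_on_of_real q2)
      show "continuous_on {0..1} ?q" by (intro continuous_on_diff q1 q2c)
      show "1 \<le> M * exp R"
        using mult_mono[of 1 M 1 "exp R"] by (simp add: M_def R_def)
      fix r :: real assume r: "r \<in> {0..1}"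
      have "radial_potential n (\<lambda>t. - (?f (\<beta> + \<delta>) t - ?f \<beta> t)) r =
          - (radial_potential n (?f (\<beta> + \<delta>)) r - radial_potential n (?f \<beta>) r)"
        using radial_potential_linear[OF continuous_on_diff[OF source_sol source_sol] r
            bounded_linear_minus[OF bounded_linear_ident], of n]
          radial_potential_diff[OF source_sol source_sol r, of n]
        by simp
      also have "\<dots> = d r - \<delta>"
        using sol_integral_eq[OF r, of "\<beta> + \<delta>"] sol_integral_eq[OF r, of \<beta>]
        unfolding d_def by linarith
      finally have "radial_potential n ?q r = (\<eta> r - of_real \<delta>) - of_real (d r - \<delta>)"
        using radial_potential_diff[OF q1 q2c r, of n]
          radial_potential_linear[OF q2 r bounded_linear_of_real[where 'a = complex], of n]
          h_eq[OF z r]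
        by (simp only: \<eta>_def) simp
      then show "norm (\<eta> r - of_real (d r)) \<le> 0 + norm (radial_potential n ?q r)"
        by simp
      \<comment> \<open>Factoring out \<open>exp (sol \<beta> r)\<close> brings the real difference
        into the form of the equation for \<open>\<eta>\<close>.\<close>
      have e: "exp (sol (\<beta> + \<delta>) r) = exp (sol \<beta> r) * exp (d r)"
        by (simp add: d_def exp_diff)
      have "?q r = - (?f \<beta> r *\<^sub>R (exp (\<eta> r) - exp (of_real (d r))))"
        unfolding e by (simp add: scaleR_conv_of_real exp_of_real algebra_simps)
      then have "norm (?q r) = \<bar>?f \<beta> r\<bar> * norm (exp (\<eta> r) - exp (of_real (d r)))"
        by (simp only: norm_minus_cancel norm_scaleR)
      also have "\<dots> \<le> M * (exp R * norm (\<eta> r - of_real (d r)))"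
        using M[OF r] h_le[OF z r] R0[OF r]
        by (intro mult_mono norm_exp_diff_le) (auto simp: R_def \<eta>_def le_max_iff_disj)
      finally show "norm (?q r) \<le> M * exp R * norm (\<eta> r - of_real (d r)) + 0"
        by (simp add: mult.assoc)
    qed auto
    then show ?thesis by (simp add: \<eta>_def d_def)
  qed
  then show thesis
    using \<open>0 < \<rho>\<close> h_hol[of 1]
    by (intro that[of \<rho> "\<lambda>z. of_real (sol \<beta> 1) + h z 1"]) (auto intro!: holomorphic_intros)
qed

section \<open>Analyticity, starting point and unboundedness of the branch\<close>

lemma branch_analytic: "real_analytic_on (\<lambda>\<beta>. (exp (sol \<beta> 1), \<beta> - sol \<beta> 1)) UNIV"
proof (rule real_analytic_on_Pair)
  fix \<beta>
  obtain \<rho> H where \<rho>: "0 < \<rho>" and H: "H holomorphic_on ball 0 \<rho>"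
    and eq: "\<And>t. \<bar>t\<bar> < \<rho> \<Longrightarrow> H (of_real t) = of_real (sol (\<beta> + t) 1)"
    by (rule sol_holomorphic_extension) blast
  show "\<exists>\<rho>>0. \<exists>F G. F holomorphic_on ball 0 \<rho> \<and> G holomorphic_on ball 0 \<rho> \<and>
    (\<forall>t. \<bar>t\<bar> < \<rho> \<longrightarrow> F (of_real t) = of_real (exp (sol (\<beta> + t) 1)) \<and>
      G (of_real t) = of_real (\<beta> + t - sol (\<beta> + t) 1))"
  proof (intro exI conjI allI impI)
    show "(\<lambda>z. exp (H z)) holomorphic_on ball 0 \<rho>"
      and "(\<lambda>z. of_real \<beta> + z - H z) holomorphic_on ball 0 \<rho>"
      by (intro holomorphic_intros H)+
  qed (simp_all add: \<rho> eq exp_of_real)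
qed

lemma branch_tendsto_0: "((\<lambda>\<beta>. (exp (sol \<beta> 1), \<beta> - sol \<beta> 1)) \<longlongrightarrow> (0, 0)) at_bot"
proof (rule tendsto_Pair)
  obtain A where A: "\<And>\<beta>. \<beta> - A * exp \<beta> \<le> sol \<beta> 1" by (rule sol_lower) blast
  show "((\<lambda>\<beta>. exp (sol \<beta> 1)) \<longlongrightarrow> 0) at_bot"
    using sol_le[of 1]
    by (intro Lim_null_comparison[OF _ exp_at_bot] always_eventually) auto
  have "((\<lambda>\<beta>. A * exp \<beta>) \<longlongrightarrow> A * 0) at_bot"
    by (intro tendsto_intros exp_at_bot)
  then have lim: "((\<lambda>\<beta>. A * exp \<beta>) \<longlongrightarrow> 0) at_bot" by simp
  have "norm (\<beta> - sol \<beta> 1) \<le> A * exp \<beta>" for \<beta>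
    using A[of \<beta>] sol_le[of 1 \<beta>] by simp
  then show "((\<lambda>\<beta>. \<beta> - sol \<beta> 1) \<longlongrightarrow> 0) at_bot"
    by (intro Lim_null_comparison[OF _ lim] always_eventually allI)
qed

lemma branch_unbounded: "\<not> bounded {(exp (sol \<beta> 1), \<beta> - sol \<beta> 1) |\<beta>. \<beta> \<in> UNIV}"
proof
  obtain B where B: "0 < B" "\<And>\<beta>. exp (sol \<beta> 1) \<le> B" by (rule exp_sol_bounded) blast
  assume "bounded {(exp (sol \<beta> 1), \<beta> - sol \<beta> 1) |\<beta>. \<beta> \<in> UNIV}"
  then obtain C where C: "\<And>\<beta>. norm (exp (sol \<beta> 1), \<beta> - sol \<beta> 1) \<le> C"
    unfolding bounded_iff by blast
  \<comment> \<open>With \<alpha> \<ge> \<beta> - ln B, this choice makes \<alpha> at least C +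
    1.\<close>
  define \<beta> where "\<beta> = C + ln B + 1"
  have "sol \<beta> 1 \<le> ln B"
    using B by (metis exp_gt_zero ln_exp ln_le_cancel_iff)
  moreover have "\<beta> - sol \<beta> 1 \<le> C"
    using norm_snd_le[of "\<beta> - sol \<beta> 1" "exp (sol \<beta> 1)"] C[of \<beta>] by simp
  ultimately show False by (simp add: \<beta>_def)
qed

end

section \<open>Radial functions on the unit ball\<close>

text \<open>Agreement on an open set suffices for iterating: the formula for first partial
  derivatives of a radial function is available on the punctured ball only.\<close>

lemma partial_deriv_cong:
  assumes "open S" "x \<in> S" "\<And>y. y \<in> S \<Longrightarrow> f y = g y"
  shows "partial_deriv b f x = partial_deriv b g x"
  unfolding partial_deriv_def
proof (rule deriv_cong_ev)
  have "((\<lambda>t::real. x + t *\<^sub>R b) \<longlongrightarrow> x + 0 *\<^sub>R b) (nhds 0)"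
    by (intro tendsto_intros filterlim_ident)
  then have "eventually (\<lambda>t. x + t *\<^sub>R b \<in> S) (nhds 0)"
    using assms by (intro topological_tendstoD) auto
  then show "\<forall>\<^sub>F t in nhds 0. f (x + t *\<^sub>R b) = g (x + t *\<^sub>R b)"
    by eventually_elim (rule assms)
qed simp

lemma norm_line_derivative:
  fixes x b :: "'a::euclidean_space"
  assumes "x \<noteq> 0"
  shows "((\<lambda>t. norm (x + t *\<^sub>R b)) has_real_derivative (x \<bullet> b) / norm x) (at 0)"
proof -
  have "((\<lambda>t::real. x + t *\<^sub>R b) has_derivative (\<lambda>t. t *\<^sub>R b)) (at 0)"
    by (auto intro!: derivative_eq_intros)
  moreover have "(norm has_derivative (\<lambda>h. h \<bullet> sgn x)) (at (x + 0 *\<^sub>R b))"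
    using has_derivative_norm[OF assms] by simp
  ultimately have "((\<lambda>t. norm (x + t *\<^sub>R b)) has_derivative (\<lambda>t. t *\<^sub>R b \<bullet> sgn x)) (at 0)"
    by (rule has_derivative_compose)
  then show ?thesis
    by (rule has_derivative_imp_has_field_derivative)
      (simp add: sgn_div_norm inner_commute field_simps)
qed

lemma partial_deriv_radial:
  fixes u :: "'a::euclidean_space \<Rightarrow> real"
  assumes u: "\<And>y. y \<in> ball 0 1 \<Longrightarrow> u y = V (norm y)"
    and V: "(V has_real_derivative D) (at (norm x))" and x: "x \<in> ball 0 1" "x \<noteq> 0"
  shows "partial_deriv b u x = D * ((x \<bullet> b) / norm x)"
proof -
  have "partial_deriv b u x = partial_deriv b (\<lambda>y. V (norm y)) x"
    by (rule partial_deriv_cong[of "ball 0 1"]) (use x u in auto)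
  also have "\<dots> = D * ((x \<bullet> b) / norm x)"
    unfolding partial_deriv_def
    by (intro DERIV_imp_deriv DERIV_chain2[OF _ norm_line_derivative[OF x(2)]]) (use V in simp)
  finally show ?thesis .
qed

text \<open>Each second partial derivative is affine in \<open>(x \<bullet> b)\<^sup>2\<close>.
  Summing over the basis turns the squares into the square of r; of the N terms V' / r one is
  cancelled.\<close>

lemma laplacian_radial:
  fixes u :: "'a::euclidean_space \<Rightarrow> real"
  assumes u: "\<And>y. y \<in> ball 0 1 \<Longrightarrow> u y = V (norm y)"
    and V: "\<And>s. s \<in> {0<..<1} \<Longrightarrow> (V has_real_derivative V' s) (at s)"
    and V': "(V' has_real_derivative D) (at (norm x))" and x: "x \<in> ball 0 1" "x \<noteq> 0"
  shows "laplacian u x = D + (real DIM('a) - 1) / norm x * V' (norm x)"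
proof -
  let ?r = "norm x"
  have r: "0 < ?r" using x by simp
  have *: "partial_deriv b (partial_deriv b u) x
      = D / ?r\<^sup>2 * (x \<bullet> b)\<^sup>2 + V' ?r / ?r - V' ?r / ?r ^ 3 * (x \<bullet> b)\<^sup>2" if b: "b \<in> Basis" for b
  proof -
    have "partial_deriv b (partial_deriv b u) x =
        partial_deriv b (\<lambda>y. V' (norm y) * ((y \<bullet> b) / norm y)) x"
    proof (rule partial_deriv_cong[of "ball 0 1 - {0}"])
      fix y :: 'a assume "y \<in> ball 0 1 - {0}"
      then show "partial_deriv b u y = V' (norm y) * ((y \<bullet> b) / norm y)"
        by (intro partial_deriv_radial[of u V] u V) auto
    qed (use x in auto)
    also have "\<dots> = deriv (\<lambda>t. V' (norm (x + t *\<^sub>R b)) * ((x \<bullet> b + t) / norm (x + t *\<^sub>R b))) 0"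
      using b by (simp add: partial_deriv_def inner_add_left inner_Basis)
    also have "\<dots> = D * ((x \<bullet> b) / ?r) * ((x \<bullet> b) / ?r)
        + (?r - (x \<bullet> b) * ((x \<bullet> b) / ?r)) / ?r\<^sup>2 * V' ?r"
    proof (rule DERIV_imp_deriv)
      have "((\<lambda>t. V' (norm (x + t *\<^sub>R b))) has_real_derivative D * ((x \<bullet> b) / ?r)) (at 0)"
        by (rule DERIV_chain2[OF _ norm_line_derivative[OF x(2)]]) (use V' in simp)
      moreover have "((\<lambda>t. (x \<bullet> b + t) / norm (x + t *\<^sub>R b)) has_real_derivative
          (?r - (x \<bullet> b) * ((x \<bullet> b) / ?r)) / ?r\<^sup>2) (at 0)"
        using r by (auto intro!: derivative_eq_intros norm_line_derivative[OF x(2)] simp: power2_eq_square)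
      ultimately show "((\<lambda>t. V' (norm (x + t *\<^sub>R b)) * ((x \<bullet> b + t) / norm (x + t *\<^sub>R b)))
          has_real_derivative D * ((x \<bullet> b) / ?r) * ((x \<bullet> b) / ?r)
            + (?r - (x \<bullet> b) * ((x \<bullet> b) / ?r)) / ?r\<^sup>2 * V' ?r) (at 0)"
        by (rule DERIV_mult[THEN DERIV_cong]) simp
    qed
    also have "\<dots> = D / ?r\<^sup>2 * (x \<bullet> b)\<^sup>2 + V' ?r / ?r - V' ?r / ?r ^ 3 * (x \<bullet> b)\<^sup>2"
      using r by (simp add: field_simps power2_eq_square power3_eq_cube)
    finally show ?thesis .
  qed
  have "(\<Sum>b\<in>Basis. (x \<bullet> b)\<^sup>2) = ?r\<^sup>2"
    unfolding power2_norm_eq_inner euclidean_inner[of x x] by (simp add: power2_eq_square)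
  moreover have "laplacian u x =
      (\<Sum>b\<in>Basis. D / ?r\<^sup>2 * (x \<bullet> b)\<^sup>2 + V' ?r / ?r - V' ?r / ?r ^ 3 * (x \<bullet> b)\<^sup>2)"
    unfolding laplacian_def by (intro sum.cong refl *)
  ultimately have "laplacian u x = D / ?r\<^sup>2 * ?r\<^sup>2 + real DIM('a) * (V' ?r / ?r) - V' ?r / ?r ^ 3 * ?r\<^sup>2"
    by (simp only: sum.distrib sum_subtractf sum_constant flip: sum_distrib_left)
  also have "\<dots> = D + (real DIM('a) - 1) / ?r * V' ?r"
    using r by (simp add: field_simps power2_eq_square power3_eq_cube)
  finally show ?thesis .
qed

text \<open>A line through the origin meets the radius \<open>\<bar>t\<bar>\<close> from both sides,
  so the one-sided derivative has to be converted into a two-sided limit.\<close>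

lemma tendsto_abs_quotient:
  fixes g :: "real \<Rightarrow> real"
  assumes "(g has_real_derivative D) (at 0 within {0..1})"
  shows "((\<lambda>t. (g \<bar>t\<bar> - g 0) / \<bar>t\<bar>) \<longlongrightarrow> D) (at 0)"
proof -
  have lim: "((\<lambda>t. (g t - g 0) / t) \<longlongrightarrow> D) (at 0 within {0..1})"
    using assms by (simp add: has_field_derivative_iff)
  have "filterlim abs (at 0 within {0..1}) (at (0::real))"
    unfolding filterlim_at
    by (auto simp: eventually_at intro!: tendsto_rabs_zero exI[of _ 1])
  from filterlim_compose[OF lim this] show ?thesis .
qed

text \<open>Along a basis line the first partial derivative is the odd extension of V', whose
  derivative at 0 is \<open>D\<close>; every basis direction contributes the same amount.\<close>

lemma laplacian_radial_0:
  fixes u :: "'a::euclidean_space \<Rightarrow> real"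
  assumes u: "\<And>y. y \<in> ball 0 1 \<Longrightarrow> u y = V (norm y)"
    and V: "\<And>s. s \<in> {0<..<1} \<Longrightarrow> (V has_real_derivative V' s) (at s)"
    and V0: "(V has_real_derivative 0) (at 0 within {0..1})"
    and V': "(V' has_real_derivative D) (at 0 within {0..1})" "V' 0 = 0"
  shows "laplacian u 0 = real DIM('a) * D"
proof -
  have "partial_deriv b (partial_deriv b u) 0 = D" if b: "b \<in> Basis" for b :: 'a
  proof -
    have "((\<lambda>t. V \<bar>t\<bar>) has_real_derivative 0) (at 0)"
    proof -
      \<comment> \<open>The difference quotient of the even extension carries a factor
        \<open>sgn t\<close>, harmless because the limit is 0.\<close>
      have "((\<lambda>t. sgn t * ((V \<bar>t\<bar> - V 0) / \<bar>t\<bar>)) \<longlongrightarrow> 0) (at 0)"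
      proof (rule Lim_null_comparison)
        show "((\<lambda>t. norm ((V \<bar>t\<bar> - V 0) / \<bar>t\<bar>)) \<longlongrightarrow> 0) (at 0)"
          using tendsto_abs_quotient[OF V0] by (rule tendsto_norm_zero)
      qed (auto simp: abs_mult sgn_if eventually_at intro!: exI[of _ 1])
      then show ?thesis
        unfolding has_field_derivative_iff
        by (rule Lim_transform_eventually) (auto simp: sgn_if eventually_at field_simps intro!: exI[of _ 1])
    qed
    then have "partial_deriv b (\<lambda>y. V (norm y)) 0 = 0"
      using b by (simp add: partial_deriv_def DERIV_imp_deriv)
    then have p0: "partial_deriv b u 0 = 0"
      using partial_deriv_cong[of "ball 0 1" 0 u "\<lambda>y. V (norm y)" b] u by simp
    have p: "partial_deriv b u (t *\<^sub>R b) = V' \<bar>t\<bar> * sgn t" if "\<bar>t\<bar> < 1" for t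
    proof (cases "t = 0")
      case False
      then have "partial_deriv b u (t *\<^sub>R b) = V' (norm (t *\<^sub>R b)) * ((t *\<^sub>R b \<bullet> b) / norm (t *\<^sub>R b))"
        using b that by (intro partial_deriv_radial[of u V, OF u] V) auto
      then show ?thesis using b False by (simp add: sgn_real_def)
    qed (use p0 V' in simp)
    have "((\<lambda>t. partial_deriv b u (t *\<^sub>R b)) has_real_derivative D) (at 0)"
      unfolding has_field_derivative_iff
      by (rule Lim_transform_eventually[OF tendsto_abs_quotient[OF V'(1)]])
        (use p p0 V'(2) in \<open>auto simp: sgn_if eventually_at intro!: exI[of _ 1]\<close>)
    then show ?thesis by (simp add: partial_deriv_def[of b "partial_deriv b u"] DERIV_imp_deriv)
  qed
  then show ?thesis by (simp add: laplacian_def)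
qed

text \<open>The Hessian of \<open>V (norm x)\<close> is \<open>p * Id + q * (s \<otimes> s)\<close> with \<open>p = V' / r\<close>, \<open>q = V'' - V' / r\<close> and
  \<open>s = sgn x\<close>; it extends continuously to \<open>0\<close> because \<open>q\<close> vanishes there.\<close>

definition radial_hessian :: "real \<Rightarrow> real \<Rightarrow> 'a::euclidean_space \<Rightarrow> 'a \<Rightarrow>\<^sub>L ('a \<Rightarrow>\<^sub>L real)" where
  "radial_hessian p q s = p *\<^sub>R Blinfun blinfun_inner_right +
     q *\<^sub>R (blinfun_scaleR_left (blinfun_inner_right s) o\<^sub>L blinfun_inner_right s)"

lemma radial_hessian_apply:
  "radial_hessian p q s h = p *\<^sub>R blinfun_inner_right h + (q * (s \<bullet> h)) *\<^sub>R blinfun_inner_right s"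
  by (simp add: radial_hessian_def blinfun.add_left blinfun.scaleR_left
      bounded_linear_Blinfun_apply[OF bounded_linear_blinfun_inner_right])

lemma norm_blinfun_inner_right_le: "norm (blinfun_inner_right s) \<le> norm s"
  for s :: "'a::euclidean_space"
  by (intro norm_blinfun_bound) (auto intro: Cauchy_Schwarz_ineq2)

lemma norm_radial_projection_le:
  fixes s :: "'a::euclidean_space"
  assumes "norm s \<le> 1"
  shows "norm (blinfun_scaleR_left (blinfun_inner_right s) o\<^sub>L blinfun_inner_right s) \<le> 1"
proof (rule norm_blinfun_bound)
  have J: "norm (blinfun_inner_right s) \<le> 1"
    using norm_blinfun_inner_right_le[of s] assms by linarith
  fix h :: 'a
  have "\<bar>s \<bullet> h\<bar> * norm (blinfun_inner_right s) \<le> (1 * norm h) * 1"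
    using J assms
    by (intro mult_mono order_trans[OF Cauchy_Schwarz_ineq2] mult_right_mono) auto
  then show "norm (blinfun_apply (blinfun_scaleR_left (blinfun_inner_right s) o\<^sub>L blinfun_inner_right s) h) \<le> 1 * norm h"
    by simp
qed simp

lemma continuous_radial_projection:
  fixes x :: "'a::euclidean_space"
  assumes "x \<noteq> 0"
  shows "continuous (at x within S)
    (\<lambda>x. blinfun_scaleR_left (blinfun_inner_right (sgn x)) o\<^sub>L blinfun_inner_right (sgn x))"
  unfolding continuous_within using assms
  by (intro bounded_bilinear.tendsto[OF bounded_bilinear_blinfun_compose]
      bounded_linear.tendsto[OF bounded_linear_blinfun_scaleR_left]
      bounded_linear.tendsto[OF bounded_linear_blinfun_inner_right] tendsto_sgn tendsto_ident_at)

theorem C2_up_to_boundary_radial: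
  fixes u :: "'a::euclidean_space \<Rightarrow> real"
  assumes u: "\<And>x. x \<in> cball 0 1 \<Longrightarrow> u x = V (norm x)"
    and V: "\<And>r. r \<in> {0..1} \<Longrightarrow> (V has_real_derivative V' r) (at r within {0..1})"
    and V': "\<And>r. r \<in> {0..1} \<Longrightarrow> (V' has_real_derivative V'' r) (at r within {0..1})"
    and V'': "continuous_on {0..1} V''" and V'0: "V' 0 = 0"
  shows "C2_up_to_boundary (ball 0 1) u"
proof -
  let ?J = "blinfun_inner_right :: 'a \<Rightarrow> 'a \<Rightarrow>\<^sub>L real"
  let ?P = "\<lambda>s::'a. blinfun_scaleR_left (?J s) o\<^sub>L ?J s"
  define p where "p r = (if r = 0 then V'' 0 else V' r / r)" for r
  define q where "q r = V'' r - p r" for r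
  have p_cont: "continuous_on {0..1} p"
    unfolding p_def by (rule continuous_on_quotient_0[OF DERIV_continuous_on[OF V'] V'0 V']) auto
  have q_cont: "continuous_on {0..1} q"
    unfolding q_def by (intro continuous_intros V'' p_cont)
  have norm_comp: "continuous_on (cball (0::'a) 1) (\<lambda>x. \<psi> (norm x))"
    if "continuous_on {0..1} \<psi>" for \<psi> :: "real \<Rightarrow> real"
    by (rule continuous_on_compose2[OF that]) (auto intro!: continuous_intros)
  \<comment> \<open>Writing the gradient as (V' / r) x instead of V' sgn x makes it continuous at 0
    and reduces its differentiability there to continuity of \<open>p\<close>.\<close>
  define f' where "f' x = p (norm x) *\<^sub>R ?J x" for x
  define f'' where "f'' x = radial_hessian (p (norm x)) (q (norm x)) (sgn x)" for x :: 'a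
  have V_at: "(V has_real_derivative V' r) (at r)" "(V' has_real_derivative V'' r) (at r)"
    if "r \<in> {0<..<1}" for r
    using V[of r] V'[of r] that at_within_interior[of r "{0..1}"] by auto
  have norm_deriv: "(norm has_derivative (\<lambda>h. h \<bullet> sgn x)) (at x)" if "x \<noteq> 0" for x :: 'a
    using has_derivative_norm[OF that] by simp
  have cl: "closure (ball (0::'a) 1) = cball 0 1" by simp
  show ?thesis
    unfolding C2_up_to_boundary_def cl
  proof (intro exI conjI ballI)
    show "continuous_on (cball 0 1) u"
      using norm_comp[OF DERIV_continuous_on[OF V]] by (rule continuous_on_eq) (simp_all add: u)
    show "continuous_on (cball 0 1) f'"
      unfolding f'_def
      by (intro continuous_intros norm_comp p_cont bounded_linear.continuous_on[OF bounded_linear_blinfun_inner_right])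
    have "continuous_on (cball 0 1) (\<lambda>x::'a. q (norm x) *\<^sub>R ?P (sgn x))"
      unfolding continuous_on_eq_continuous_within
    proof
      fix x :: 'a assume x: "x \<in> cball 0 1"
      have qx: "continuous (at x within cball 0 1) (\<lambda>x. q (norm x))"
        using norm_comp[OF q_cont] x by (auto simp: continuous_on_eq_continuous_within)
      show "continuous (at x within cball 0 1) (\<lambda>x. q (norm x) *\<^sub>R ?P (sgn x))"
      proof (cases "x = 0")
        case True
        have "((\<lambda>x::'a. norm (q (norm x))) \<longlongrightarrow> 0) (at 0 within cball 0 1)"
          using qx True by (intro tendsto_norm_zero) (simp add: continuous_within q_def p_def)
        moreover have "norm (q (norm x) *\<^sub>R ?P (sgn x)) \<le> norm (q (norm x))" for x :: 'a
        proof -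
          have "norm (?P (sgn x)) \<le> 1"
            by (rule norm_radial_projection_le) (simp add: norm_sgn)
          from mult_left_mono[OF this, of "\<bar>q (norm x)\<bar>"] show ?thesis
            unfolding norm_scaleR real_norm_def by simp
        qed
        ultimately have "((\<lambda>x::'a. q (norm x) *\<^sub>R ?P (sgn x)) \<longlongrightarrow> 0) (at 0 within cball 0 1)"
          by (rule Lim_null_comparison[OF always_eventually[OF allI], rotated])
        then show ?thesis using True by (simp add: continuous_within q_def p_def)
      qed (intro continuous_intros qx continuous_radial_projection)
    qed
    then show "continuous_on (cball 0 1) f''"
      unfolding f''_def radial_hessian_def
      by (rule continuous_on_add[rotated]) (intro continuous_intros norm_comp p_cont)
    fix x :: 'a assume x: "x \<in> ball 0 1"
    show "(u has_derivative f' x) (at x)"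
    proof (cases "x = 0")
      case True
      have "(u has_derivative (\<lambda>h. 0)) (at 0)"
      proof (rule has_derivativeI_sandwich[of 1])
        have "((\<lambda>t. (V \<bar>t\<bar> - V 0) / \<bar>t\<bar>) \<longlongrightarrow> 0) (at 0)"
          using V[of 0] V'0 by (intro tendsto_abs_quotient) auto
        moreover have "filterlim norm (at 0) (at (0::'a))"
          unfolding filterlim_at by (auto simp: eventually_at intro!: tendsto_norm_zero exI[of _ 1])
        ultimately have "((\<lambda>y::'a. (V \<bar>norm y\<bar> - V 0) / \<bar>norm y\<bar>) \<longlongrightarrow> 0) (at 0)"
          by (rule filterlim_compose)
        then show "((\<lambda>y::'a. norm ((V \<bar>norm y\<bar> - V 0) / \<bar>norm y\<bar>)) \<longlongrightarrow> 0) (at 0)"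
          by (rule tendsto_norm_zero)
      qed (use u in auto)
      moreover have "blinfun_apply (f' x) = (\<lambda>h. 0)"
        using True by (auto simp: f'_def blinfun.scaleR_left)
      ultimately show ?thesis using True by simp
    next
      case False
      have "((\<lambda>y. V (norm y)) has_derivative (\<lambda>h. (h \<bullet> sgn x) * V' (norm x))) (at x)"
        using has_derivative_compose[OF norm_deriv[OF False]
            V_at(1)[of "norm x", THEN has_field_derivative_imp_has_derivative]] False x
        by (simp add: mult.commute)
      then have "(u has_derivative (\<lambda>h. (h \<bullet> sgn x) * V' (norm x))) (at x)"
        by (rule has_derivative_transform_within_open[of _ _ _ _ "ball 0 1"]) (use u x in auto)
      moreover have "blinfun_apply (f' x) = (\<lambda>h. (h \<bullet> sgn x) * V' (norm x))"
        using False
        by (simp add: fun_eq_iff f'_def p_def blinfun.scaleR_left sgn_div_norm inner_commute field_simps)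
      ultimately show ?thesis by simp
    qed
    show "(f' has_derivative f'' x) (at x)"
    proof (cases "x = 0")
      case True
      have "(f' has_derivative (\<lambda>h. p 0 *\<^sub>R ?J h)) (at 0)"
      proof (rule has_derivativeI_sandwich[of 1])
        show "bounded_linear (\<lambda>h. p 0 *\<^sub>R ?J h)"
          by (intro bounded_linear_const_scaleR bounded_linear_blinfun_inner_right)
        have "continuous (at 0) (\<lambda>x::'a. p (norm x))"
          using continuous_on_subset[OF norm_comp[OF p_cont] ball_subset_cball]
          by (simp add: continuous_on_eq_continuous_at)
        then have "((\<lambda>x::'a. p (norm x) - p 0) \<longlongrightarrow> p 0 - p 0) (at 0)"
          by (intro tendsto_intros) (simp add: continuous_at)
        then show "((\<lambda>x::'a. norm (p (norm x) - p 0)) \<longlongrightarrow> 0) (at 0)"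
          by (intro tendsto_norm_zero) simp
        fix y :: 'a assume "y \<noteq> 0"
        have "norm ((p (norm y) - p 0) *\<^sub>R ?J y) \<le> norm (p (norm y) - p 0) * norm y"
          by (simp add: mult_left_mono norm_blinfun_inner_right_le)
        moreover have "f' y - f' 0 - p 0 *\<^sub>R ?J (y - 0) = (p (norm y) - p 0) *\<^sub>R ?J y"
        proof -
          have "?J 0 = 0" by (intro blinfun_eqI) simp
          then show ?thesis by (simp add: f'_def scaleR_diff_left)
        qed
        ultimately show "norm (f' y - f' 0 - p 0 *\<^sub>R ?J (y - 0)) / norm (y - 0) \<le> norm (p (norm y) - p 0)"
          using \<open>y \<noteq> 0\<close> by (simp add: field_simps)
      qed simp
      moreover have "blinfun_apply (f'' 0) = (\<lambda>h. p 0 *\<^sub>R ?J h)"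
        by (simp add: fun_eq_iff f''_def radial_hessian_apply q_def p_def)
      ultimately show ?thesis using True by simp
    next
      case False
      let ?r = "norm x"
      have r: "?r \<in> {0<..<1}" using False x by simp
      have "((\<lambda>r. V' r / r) has_real_derivative q ?r / ?r) (at ?r)"
        using r V_at(2)[OF r]
        by (auto intro!: derivative_eq_intros simp: q_def p_def field_simps)
      then have "(p has_real_derivative q ?r / ?r) (at ?r)"
        by (rule has_field_derivative_transform_within_open[of _ _ _ "{0<..}"])
          (use r in \<open>auto simp: p_def\<close>)
      from has_derivative_compose[OF norm_deriv[OF False] has_field_derivative_imp_has_derivative[OF this]]
      have "((\<lambda>y. p (norm y)) has_derivative (\<lambda>h. q ?r / ?r * (h \<bullet> sgn x))) (at x)" .
      from has_derivative_scaleR[OF this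
          bounded_linear.has_derivative[OF bounded_linear_blinfun_inner_right has_derivative_ident]]
      have "(f' has_derivative (\<lambda>h. p ?r *\<^sub>R ?J h + (q ?r / ?r * (h \<bullet> sgn x)) *\<^sub>R ?J x)) (at x)"
        unfolding f'_def .
      \<comment> \<open>The factor \<open>?r\<close> cancels the \<open>1 / ?r\<close> produced by
        differentiating \<open>p\<close>.\<close>
      moreover have "?J x = ?r *\<^sub>R ?J (sgn x)"
        using False by (intro blinfun_eqI) (simp add: blinfun.scaleR_left sgn_div_norm)
      ultimately show ?thesis
        using r by (simp add: f''_def radial_hessian_apply[abs_def] inner_commute)
    qed
  qed
qed

section \<open>Radial solutions of the boundary value problem\<close>

text \<open>\<open>g\<close> is the integral of \<open>g'\<close>, and integrals of continuous
  functions have one-sided derivatives at the end points as well.\<close>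

lemma has_real_derivative_up_to_boundary:
  fixes g g' :: "real \<Rightarrow> real"
  assumes g: "continuous_on {0..1} g" and g': "continuous_on {0..1} g'"
    and deriv: "\<And>r. r \<in> {0<..<1} \<Longrightarrow> (g has_real_derivative g' r) (at r)"
    and r: "r \<in> {0..1}"
  shows "(g has_real_derivative g' r) (at r within {0..1})"
proof -
  have eq: "g 0 + integral {0..x} g' = g x" if x: "x \<in> {0..1}" for x
  proof -
    have "(g' has_integral g x - g 0) {0..x}"
    proof (rule fundamental_theorem_of_calculus_interior)
      fix t assume "t \<in> {0<..<x}"
      then show "(g has_vector_derivative g' t) (at t)"
        using deriv[of t] x by (simp add: has_real_derivative_iff_has_vector_derivative)
    qed (use x in \<open>auto intro: continuous_on_subset[OF g]\<close>)
    then show ?thesis by (simp add: integral_unique)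
  qed
  have "((\<lambda>x. g 0 + integral {0..x} g') has_real_derivative g' r) (at r within {0..1})"
    using DERIV_add[OF DERIV_const integral_has_real_derivative[OF g' r]] by simp
  then show ?thesis
    by (rule has_field_derivative_transform_within[where d = 1]) (use r eq in auto)
qed

text \<open>Restriction to a ray. Radial symmetry makes u even along the line through
  \<open>e\<close>, so its derivative at the centre equals its own negative, whence
  \<open>V' 0 = 0\<close>.\<close>

lemma C2_up_to_boundary_radial_profile:
  fixes u :: "'a::euclidean_space \<Rightarrow> real"
  assumes C2: "C2_up_to_boundary (ball 0 1) u"
    and radial: "\<And>x. x \<in> cball 0 1 \<Longrightarrow> u x = w (norm x)" and e: "norm e = 1"
  obtains V' V'' where
    "\<And>r. r \<in> {0..1} \<Longrightarrow> ((\<lambda>r. u (r *\<^sub>R e)) has_real_derivative V' r) (at r within {0..1})"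
    "\<And>r. r \<in> {0..1} \<Longrightarrow> (V' has_real_derivative V'' r) (at r within {0..1})"
    "continuous_on {0..1} V''" "V' 0 = 0"
proof -
  have cl: "closure (ball (0::'a) 1) = cball 0 1" by simp
  obtain f' :: "'a \<Rightarrow> 'a \<Rightarrow>\<^sub>L real" and f'' :: "'a \<Rightarrow> 'a \<Rightarrow>\<^sub>L ('a \<Rightarrow>\<^sub>L real)"
    where cont: "continuous_on (cball 0 1) u" "continuous_on (cball 0 1) f'" "continuous_on (cball 0 1) f''"
      and f': "\<And>x. x \<in> ball 0 1 \<Longrightarrow> (u has_derivative f' x) (at x)"
      and f'': "\<And>x. x \<in> ball 0 1 \<Longrightarrow> (f' has_derivative f'' x) (at x)"
    using C2 unfolding C2_up_to_boundary_def cl by blast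
  have line: "continuous_on {0..1} (\<lambda>r. F (r *\<^sub>R e))"
    if "continuous_on (cball 0 1) F" for F :: "'a \<Rightarrow> 'b::topological_space"
    by (rule continuous_on_compose2[OF that]) (use e in \<open>auto intro!: continuous_intros\<close>)
  have line_deriv: "((\<lambda>r. r *\<^sub>R e) has_derivative (\<lambda>h. h *\<^sub>R e)) (at r)" for r
    by (auto intro!: derivative_eq_intros)
  have V: "((\<lambda>r. u (r *\<^sub>R e)) has_real_derivative f' (r *\<^sub>R e) e) (at r)" if "\<bar>r\<bar> < 1" for r
  proof -
    have "((\<lambda>r. u (r *\<^sub>R e)) has_derivative (\<lambda>h. f' (r *\<^sub>R e) (h *\<^sub>R e))) (at r)"
      using that e by (intro has_derivative_compose[OF line_deriv f']) auto
    then show ?thesis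
      by (rule has_derivative_imp_has_field_derivative) (simp add: blinfun.scaleR_right)
  qed
  have V': "((\<lambda>r. f' (r *\<^sub>R e) e) has_real_derivative f'' (r *\<^sub>R e) e e) (at r)" if "\<bar>r\<bar> < 1" for r
  proof -
    have "((\<lambda>r. f' (r *\<^sub>R e)) has_derivative (\<lambda>h. f'' (r *\<^sub>R e) (h *\<^sub>R e))) (at r)"
      using that e by (intro has_derivative_compose[OF line_deriv f'']) auto
    then have "((\<lambda>r. f' (r *\<^sub>R e) e) has_derivative (\<lambda>h. f'' (r *\<^sub>R e) (h *\<^sub>R e) e)) (at r)"
      by (rule bounded_linear.has_derivative[OF blinfun.bounded_linear_left])
    then show ?thesis
      by (rule has_derivative_imp_has_field_derivative)
        (simp add: blinfun.scaleR_right blinfun.scaleR_left)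
  qed
  have V'c: "continuous_on {0..1} (\<lambda>r. f' (r *\<^sub>R e) e)"
    by (intro bounded_linear.continuous_on[OF blinfun.bounded_linear_left] line cont)
  have V''c: "continuous_on {0..1} (\<lambda>r. f'' (r *\<^sub>R e) e e)"
    by (intro bounded_linear.continuous_on[OF blinfun.bounded_linear_left] line cont)
  have "f' 0 e = 0"
  proof -
    have "((\<lambda>r. u (- r *\<^sub>R e)) has_real_derivative f' 0 e * - 1) (at 0)"
      by (rule DERIV_chain2[of "\<lambda>r. u (r *\<^sub>R e)" "f' 0 e" uminus 0])
        (use V[of 0] in \<open>auto intro!: derivative_eq_intros\<close>)
    then have "((\<lambda>r. u (r *\<^sub>R e)) has_real_derivative f' 0 e * - 1) (at 0)"
      by (rule has_field_derivative_transform_within_open[of _ _ _ "{-1<..<1}"])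
        (use e in \<open>auto simp: radial\<close>)
    then show ?thesis
      using DERIV_unique[OF _ V[of 0], of "f' 0 e * - 1"] by simp
  qed
  then show thesis
    using has_real_derivative_up_to_boundary[OF line[OF cont(1)] V'c V]
      has_real_derivative_up_to_boundary[OF V'c V''c V'] V''c
    by (intro that[of "\<lambda>r. f' (r *\<^sub>R e) e" "\<lambda>r. f'' (r *\<^sub>R e) e e"]) auto
qed

text \<open>If the essential supremum were below \<open>c < f 0\<close>, the set where
  \<open>f > c\<close> would be a null set; but it is open and contains 0.\<close>

lemma Linf_norm_attained_at_0:
  fixes f :: "'a::euclidean_space \<Rightarrow> real"
  assumes f: "continuous_on (ball 0 1) f" and le: "\<And>x. x \<in> ball 0 1 \<Longrightarrow> \<bar>f x\<bar> \<le> f 0"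
  shows "Linf_norm (ball 0 1) f = ereal (f 0)"
proof (rule antisym)
  have "(\<lambda>x. \<bar>f x\<bar>) \<in> borel_measurable (lebesgue_on (ball 0 1))"
    by (intro continuous_imp_measurable_on_sets_lebesgue continuous_intros f) auto
  then have meas: "(\<lambda>x. ereal \<bar>f x\<bar>) \<in> borel_measurable (lebesgue_on (ball 0 1))"
    by measurable
  show "Linf_norm (ball 0 1) f \<le> ereal (f 0)"
    unfolding Linf_norm_def using le
    by (intro esssup_I meas AE_I2) (auto simp: space_restrict_space)
  show "ereal (f 0) \<le> Linf_norm (ball 0 1) f"
  proof (rule ccontr)
    assume "\<not> ereal (f 0) \<le> Linf_norm (ball 0 1) f"
    then obtain c where c: "Linf_norm (ball 0 1) f < ereal c" "c < f 0"
      using ereal_dense2[of "Linf_norm (ball 0 1) f" "ereal (f 0)"] by (auto simp: not_le)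
    define T where "T = ball 0 1 \<inter> f -` {c<..}"
    have "open T"
      unfolding T_def by (rule continuous_open_preimage[OF f]) auto
    moreover have "0 \<in> T" using c by (simp add: T_def)
    moreover have "negligible T"
    proof -
      have "AE x in lebesgue_on (ball 0 1). ereal \<bar>f x\<bar> \<le> Linf_norm (ball 0 1) f"
        unfolding Linf_norm_def by (rule esssup_AE)
      then have "AE x in lebesgue. x \<in> ball 0 1 \<longrightarrow> ereal \<bar>f x\<bar> \<le> Linf_norm (ball 0 1) f"
        by (subst (asm) AE_restrict_space_iff) auto
      then obtain X where X: "{x \<in> space lebesgue. \<not> (x \<in> ball 0 1 \<longrightarrow> ereal \<bar>f x\<bar> \<le> Linf_norm (ball 0 1) f)} \<subseteq> X"
        "emeasure lebesgue X = 0" "X \<in> sets lebesgue"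
        by (rule AE_E)
      have "\<not> ereal \<bar>f x\<bar> \<le> Linf_norm (ball 0 1) f" if "x \<in> T" for x
      proof -
        have "c < f x" using that by (simp add: T_def)
        then have "ereal c < ereal \<bar>f x\<bar>" using abs_ge_self[of "f x"] by simp
        with c(1) show ?thesis by (meson less_trans not_le)
      qed
      then have "T \<subseteq> X" using X(1) by (auto simp: T_def)
      moreover have "negligible X"
        using X by (simp add: negligible_iff_null_sets null_sets_def)
      ultimately show ?thesis by (rule negligible_subset[rotated])
    qed
    ultimately show False using open_not_negligible by blast
  qed
qed

context radial_ode
begin

text \<open>The problem imposes no equation at r = 0. Letting r tend to 0, where v' / r tends to v''
  0, supplies the value needed for the Laplacian at the centre.\<close>

lemma sol_profile:
  obtains v' v'' where
    "\<And>r. r \<in> {0..1} \<Longrightarrow> (sol \<beta> has_real_derivative v' r) (at r within {0..1})"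
    "\<And>r. r \<in> {0..1} \<Longrightarrow> (v' has_real_derivative v'' r) (at r within {0..1})"
    "continuous_on {0..1} v''" "v' 0 = 0"
    "\<And>r. r \<in> {0<..1} \<Longrightarrow> v'' r + real n / r * v' r = - (a r * exp (sol \<beta> r))"
    "(real n + 1) * v'' 0 = - (a 0 * exp \<beta>)"
proof -
  obtain v' v'' where v': "\<And>r. r \<in> {0..1} \<Longrightarrow> (sol \<beta> has_real_derivative v' r) (at r within {0..1})"
    and v'': "\<And>r. r \<in> {0..1} \<Longrightarrow> (v' has_real_derivative v'' r) (at r within {0..1})"
    and c: "continuous_on {0..1} v''" and v'0: "v' 0 = 0"
    and eq: "\<And>r. r \<in> {0<..1} \<Longrightarrow> - (v'' r + real n / r * v' r) = a r * exp (sol \<beta> r)"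
    using sol[of \<beta>] unfolding radial_ivp_solution_def of_nat_Suc add_diff_cancel_left' by blast
  define p where "p r = (if r = 0 then v'' 0 else v' r / r)" for r
  have p_cont: "continuous_on {0..1} p"
    unfolding p_def by (rule continuous_on_quotient_0[OF DERIV_continuous_on[OF v''] v'0 v'']) auto
  have cl: "closure {0<..1} = {0..1::real}" by simp
  have "v'' 0 + real n * p 0 + a 0 * exp (sol \<beta> 0) = 0"
  proof (rule continuous_constant_on_closure[of "{0<..1}"
        "\<lambda>r. v'' r + real n * p r + a r * exp (sol \<beta> r)"])
    show "continuous_on (closure {0<..1}) (\<lambda>r. v'' r + real n * p r + a r * exp (sol \<beta> r))"
      unfolding cl by (intro continuous_intros c p_cont source_sol)
    fix r :: real assume "r \<in> {0<..1}"
    with eq[of r] show "v'' r + real n * p r + a r * exp (sol \<beta> r) = 0"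
      by (simp add: p_def)
  qed simp
  then have "(real n + 1) * v'' 0 = - (a 0 * exp \<beta>)"
    by (simp add: p_def sol_0 algebra_simps)
  moreover have "v'' r + real n / r * v' r = - (a r * exp (sol \<beta> r))" if "r \<in> {0<..1}" for r
    using eq[OF that] by linarith
  ultimately show thesis using v' v'' c v'0 by (intro that)
qed

theorem branch_radial_solution:
  assumes dim: "DIM('a::euclidean_space) = Suc n"
    and u: "\<And>x::'a. x \<in> cball 0 1 \<Longrightarrow> u x = sol \<beta> (norm x) - sol \<beta> 1"
  shows "radial_solution a (exp (sol \<beta> 1)) u"
proof -
  obtain v' v'' where v': "\<And>r. r \<in> {0..1} \<Longrightarrow> (sol \<beta> has_real_derivative v' r) (at r within {0..1})"
    and v'': "\<And>r. r \<in> {0..1} \<Longrightarrow> (v' has_real_derivative v'' r) (at r within {0..1})"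
    and c: "continuous_on {0..1} v''" and v'0: "v' 0 = 0"
    and eq: "\<And>r. r \<in> {0<..1} \<Longrightarrow> v'' r + real n / r * v' r = - (a r * exp (sol \<beta> r))"
    and eq0: "(real n + 1) * v'' 0 = - (a 0 * exp \<beta>)"
    by (rule sol_profile[of \<beta>]) blast
  let ?V = "\<lambda>r. sol \<beta> r - sol \<beta> 1"
  have V: "(?V has_real_derivative v' r) (at r within {0..1})" if "r \<in> {0..1}" for r
    using DERIV_diff[OF v'[OF that] DERIV_const] by simp
  have at: "(?V has_real_derivative v' r) (at r)" "(v' has_real_derivative v'' r) (at r)"
    if "r \<in> {0<..<1}" for r
    using V[of r] v''[of r] that at_within_interior[of r "{0..1}"] by auto
  have u_ball: "u y = ?V (norm y)" if "y \<in> ball 0 1" for y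
    using u that by simp
  show ?thesis
    unfolding radial_solution_def
  proof (intro conjI ballI exI)
    show "C2_up_to_boundary (ball 0 1) u"
      by (rule C2_up_to_boundary_radial[OF u V v'' c v'0])
    fix x :: 'a
    { assume "x \<in> cball 0 1" then show "u x = ?V (norm x)" by (rule u) }
    { assume "x \<in> sphere 0 1" then show "u x = 0" using u[of x] by simp }
    assume x: "x \<in> ball 0 1"
    then show "0 < u x"
      using u_ball sol_strict_decreasing[of "norm x" 1 \<beta>] by simp
    have "laplacian u x = - (a (norm x) * exp (sol \<beta> (norm x)))"
    proof (cases "x = 0")
      case True
      have "laplacian u 0 = real DIM('a) * v'' 0"
        by (rule laplacian_radial_0[of u ?V v', OF u_ball at(1)])
          (use V[of 0] v''[of 0] v'0 in auto)
      with True eq0 dim show ?thesis by (simp add: sol_0 add.commute)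
    next
      case False
      then have "laplacian u x = v'' (norm x) + (real DIM('a) - 1) / norm x * v' (norm x)"
        using x by (intro laplacian_radial[of u ?V v', OF u_ball at(1)] at(2)) auto
      with eq[of "norm x"] False x dim show ?thesis by simp
    qed
    then show "- laplacian u x = exp (sol \<beta> 1) * a (norm x) * exp (u x)"
      using u_ball[OF x] by (simp add: exp_diff)
  qed simp
qed

theorem radial_solution_in_branch:
  fixes u :: "'a::euclidean_space \<Rightarrow> real"
  assumes dim: "DIM('a) = Suc n" and solution: "radial_solution a lam u"
  obtains \<beta> where "lam = exp (sol \<beta> 1)"
    "\<And>x. x \<in> cball 0 1 \<Longrightarrow> u x = sol \<beta> (norm x) - sol \<beta> 1"
proof -
  obtain w where lam: "0 < lam" and C2: "C2_up_to_boundary (ball 0 1) u"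
    and w: "\<And>x. x \<in> cball 0 1 \<Longrightarrow> u x = w (norm x)"
    and pde: "\<And>x. x \<in> ball 0 1 \<Longrightarrow> - laplacian u x = lam * a (norm x) * exp (u x)"
    and bdry: "\<And>x. x \<in> sphere 0 1 \<Longrightarrow> u x = 0"
    using solution unfolding radial_solution_def by blast
  obtain e :: 'a where e: "norm e = 1"
    using nonempty_Basis norm_Basis by blast
  let ?V = "\<lambda>r. u (r *\<^sub>R e)"
  obtain V' V'' where V: "\<And>r. r \<in> {0..1} \<Longrightarrow> (?V has_real_derivative V' r) (at r within {0..1})"
    and V': "\<And>r. r \<in> {0..1} \<Longrightarrow> (V' has_real_derivative V'' r) (at r within {0..1})"
    and c: "continuous_on {0..1} V''" and V'0: "V' 0 = 0"
    by (rule C2_up_to_boundary_radial_profile[OF C2 w e]) (assumption, rule that)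
  have at: "(?V has_real_derivative V' r) (at r)" "(V' has_real_derivative V'' r) (at r)"
    if "r \<in> {0<..<1}" for r
    using V[of r] V'[of r] that at_within_interior[of r "{0..1}"] by auto
  have u_V: "u x = ?V (norm x)" if "x \<in> cball 0 1" for x
    using w[of x] w[of "norm x *\<^sub>R e"] e that by simp
  \<comment> \<open>The shift absorbs the parameter:
    \<open>lam * exp (?V r) = exp (v r)\<close>.\<close>
  define v where "v r = ?V r + ln lam" for r
  have v_cont: "continuous_on {0..1} v"
    unfolding v_def by (intro continuous_intros DERIV_continuous_on[OF V])
  define p where "p r = (if r = 0 then V'' 0 else V' r / r)" for r
  have p_cont: "continuous_on {0..1} p"
    unfolding p_def by (rule continuous_on_quotient_0[OF DERIV_continuous_on[OF V'] V'0 V']) auto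
  have cl: "closure {0<..<1} = {0..1::real}" by simp
  \<comment> \<open>The polar form of the Laplacian is available for 0 < r < 1 only; both end points
    follow by continuity, and r = 1 is part of the initial value problem.\<close>
  have ode: "V'' r + real n * p r + a r * exp (v r) = 0" if r: "r \<in> {0..1}" for r
  proof (rule continuous_constant_on_closure[of "{0<..<1}"
        "\<lambda>r. V'' r + real n * p r + a r * exp (v r)"])
    show "continuous_on (closure {0<..<1}) (\<lambda>r. V'' r + real n * p r + a r * exp (v r))"
      unfolding cl by (intro continuous_intros c p_cont source_continuous v_cont)
    fix r :: real assume r: "r \<in> {0<..<1}"
    have "laplacian u (r *\<^sub>R e) = V'' (norm (r *\<^sub>R e)) + (real DIM('a) - 1) / norm (r *\<^sub>R e) * V' (norm (r *\<^sub>R e))"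
      using r e by (intro laplacian_radial[of u ?V V' "V'' (norm (r *\<^sub>R e))"] u_V at) auto
    also have "\<dots> = V'' r + real n * p r"
      using r e dim by (simp add: p_def)
    finally show "V'' r + real n * p r + a r * exp (v r) = 0"
      using pde[of "r *\<^sub>R e"] r e lam by (simp add: v_def exp_add mult_ac)
  qed (use r cl in auto)
  define \<beta> where "\<beta> = v 0"
  have "radial_ivp_solution (Suc n) a \<beta> v"
    unfolding radial_ivp_solution_def
  proof (intro exI conjI ballI)
    fix r :: real
    show "(v has_real_derivative V' r) (at r within {0..1})" if "r \<in> {0..1}"
      unfolding v_def using DERIV_add[OF V[OF that] DERIV_const] by simp
    show "(V' has_real_derivative V'' r) (at r within {0..1})" if "r \<in> {0..1}"
      by (rule V'[OF that])
    show "- (V'' r + (real (Suc n) - 1) / r * V' r) = a r * exp (v r)" if "r \<in> {0<..1}"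
      using ode[of r] that by (simp add: p_def)
  qed (simp_all add: c V'0 \<beta>_def)
  then have v: "v r = sol \<beta> r" if "r \<in> {0..1}" for r
    using sol_unique that by blast
  have v1: "v 1 = ln lam" using bdry[of e] e by (simp add: v_def)
  show thesis
  proof (rule that[of \<beta>])
    show "lam = exp (sol \<beta> 1)" using v1 v[of 1] lam by simp
    fix x :: 'a assume x: "x \<in> cball 0 1"
    have "u x = v (norm x) - v 1" using u_V[OF x] v1 by (simp add: v_def)
    then show "u x = sol \<beta> (norm x) - sol \<beta> 1" using v x by simp
  qed
qed

end

theorem theorem1p1:
  fixes a :: "real \<Rightarrow> real"
  assumes "CARD('n::finite) \<ge> 3"
    and "C2_up_to_boundary (ball 0 1) (\<lambda>x::real^'n. a (norm x))"
    and "\<forall>r\<in>{0..1}. 0 < a r"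
    and "a 0 = 1"
  shows "let lam = branch_lambda CARD('n) a;
             u = (\<lambda>\<beta>. branch_u a \<beta> :: real^'n \<Rightarrow> real);
             \<alpha> = (\<lambda>\<beta>. real_of_ereal (Linf_norm (ball 0 1) (u \<beta>)))
         in radial_solutions a = {(lam \<beta>, u \<beta>) |\<beta>. \<beta> \<in> UNIV} \<and>
            (\<forall>\<beta>. Linf_norm (ball 0 1) (u \<beta>) = ereal (\<alpha> \<beta>) \<and> \<alpha> \<beta> = \<beta> - ln (lam \<beta>)) \<and>
            \<not> bounded {(lam \<beta>, \<alpha> \<beta>) |\<beta>. \<beta> \<in> UNIV} \<and>
            real_analytic_on (\<lambda>\<beta>. (lam \<beta>, \<alpha> \<beta>)) UNIV \<and>
            ((\<lambda>\<beta>. (lam \<beta>, \<alpha> \<beta>)) \<longlongrightarrow> (0, 0)) at_bot \<and>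
            (\<exists>lam_star>0. \<forall>\<beta>. lam \<beta> \<le> lam_star)"
proof -
  obtain n where n: "CARD('n) = Suc n"
    using assms(1) by (cases "CARD('n)") auto
  have dim: "DIM(real^'n) = Suc n" using n by simp
  obtain e :: "real^'n" where e: "norm e = 1"
    using nonempty_Basis norm_Basis by blast
  interpret radial_ode n a
  proof
    have "continuous_on (cball 0 1) (\<lambda>x::real^'n. a (norm x))"
      using assms(2) unfolding C2_up_to_boundary_def by auto
    \<comment> \<open>Continuity of \<open>a\<close> is read off along a ray of the ball.\<close>
    then have "continuous_on {0..1} (\<lambda>r. a (norm (r *\<^sub>R e)))"
      by (rule continuous_on_compose2) (use e in \<open>auto intro!: continuous_intros\<close>)
    then show "continuous_on {0..1} a"
      by (rule continuous_on_eq) (use e in auto)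
  qed (use assms(3) in blast)
  have lam: "branch_lambda CARD('n) a = (\<lambda>\<beta>. exp (sol \<beta> 1))"
    by (simp add: branch_lambda_def n fun_eq_iff)
  let ?u = "\<lambda>\<beta>. branch_u a \<beta> :: real^'n \<Rightarrow> real"
  have u: "?u \<beta> x = sol \<beta> (norm x) - sol \<beta> 1" if "x \<in> cball 0 1" for \<beta> x
    using that unfolding branch_u_def branch_lambda_def dim by simp
  have u_ext: "?u \<beta> \<in> extensional (cball 0 1)" for \<beta>
    unfolding branch_u_def by simp
  have Linf: "Linf_norm (ball 0 1) (?u \<beta>) = ereal (\<beta> - sol \<beta> 1)" for \<beta>
  proof -
    have "continuous_on (ball (0::real^'n) 1) (\<lambda>x. sol \<beta> (norm x) - sol \<beta> 1)"
      by (intro continuous_intros continuous_on_compose2[OF sol_continuous]) auto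
    then have "continuous_on (ball 0 1) (?u \<beta>)"
      by (rule continuous_on_eq) (use u in auto)
    \<comment> \<open>The profile decreases to 0 at the boundary, so the maximum of the modulus sits
      at the centre.\<close>
    moreover have "\<bar>?u \<beta> x\<bar> \<le> ?u \<beta> 0" if "x \<in> ball 0 1" for x
      using that u[of x \<beta>] u[of 0 \<beta>] sol_0 sol_le[of "norm x" \<beta>] sol_decreasing[of "norm x" 1 \<beta>]
      by simp
    ultimately show ?thesis
      using Linf_norm_attained_at_0[of "?u \<beta>"] u[of 0 \<beta>] sol_0 by simp
  qed
  have solutions: "radial_solutions a = {(exp (sol \<beta> 1), ?u \<beta>) |\<beta>. \<beta> \<in> UNIV}"
  proof (intro equalityI subsetI)
    fix s :: "real \<times> (real^'n \<Rightarrow> real)" assume "s \<in> radial_solutions a"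
    then obtain l w where s: "s = (l, w)" and w: "radial_solution a l w" "w \<in> extensional (cball 0 1)"
      unfolding radial_solutions_def by blast
    obtain \<beta> where \<beta>: "l = exp (sol \<beta> 1)"
      "\<And>x. x \<in> cball 0 1 \<Longrightarrow> w x = sol \<beta> (norm x) - sol \<beta> 1"
      by (rule radial_solution_in_branch[OF dim w(1)]) blast
    have "w = ?u \<beta>"
      using \<beta>(2) u by (intro extensionalityI[OF w(2) u_ext]) simp
    with s \<beta>(1) show "s \<in> {(exp (sol \<beta> 1), ?u \<beta>) |\<beta>. \<beta> \<in> UNIV}" by blast
  next
    fix s assume "s \<in> {(exp (sol \<beta> 1), ?u \<beta>) |\<beta>. \<beta> \<in> UNIV}"
    then show "s \<in> radial_solutions a"
      unfolding radial_solutions_def using branch_radial_solution[OF dim u] u_ext by blast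
  qed
  obtain B where "0 < B" "\<And>\<beta>. exp (sol \<beta> 1) \<le> B" by (rule exp_sol_bounded) blast
  then show ?thesis
    using solutions branch_unbounded branch_analytic branch_tendsto_0
    unfolding Let_def lam Linf by auto
qed

end
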